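(* For each $n$ let $\mathcal{C},\mathcal{C}'$ be conjugacy classes of $S_n$ whose elements have $c_j$ (resp. $c'_j$) $j$-cycles. Let $\pi\in\mathcal{C}$, $\pi'\in\mathcal{C}'$ be independent and uniform, and let $N$ be the number of orbits of $\langle\pi,\pi'\rangle$ on $\{1,\dots,n\}$ of size $k$ with $1\leq k\leq n/2$. \begin{enumerate} \item If $c_1+c'_1=o(n^{2/3})$ and $(c_1+c_2^{1/2})(c'_1+{c'_2}^{1/2})=o(n)$, then $\mathbf{E} N=o(1)$. \item If $c_1+c'_1=O(n^{2/3})$, $(c_1+c_2^{1/2})(c'_1+{c'_2}^{1/2})=O(n)$, and there is a constant $\epsilon>0$ with $c_2+c'_2\leq(1-\epsilon)n$, then $\mathbf{E} N=O(1)$. \end{enumerate}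
   Context: Asymptotic notation is with respect to $n\to\infty$. *)

theory Defs
  imports "HOL-Probability.Probability" "HOL-Combinatorics.Permutations" "HOL-Library.Landau_Symbols"
begin

text \<open>Permutations of the n-point set are modelled as functions on nat that permute
  {..<n} (ground set {0,...,n-1} instead of {1,...,n}).\<close>

definition cyc :: "(nat \<Rightarrow> nat) \<Rightarrow> nat \<Rightarrow> nat set" where
  "cyc p x = {(p ^^ k) x | k. True}"

definition cycle_count :: "nat \<Rightarrow> (nat \<Rightarrow> nat) \<Rightarrow> nat \<Rightarrow> nat" where
  "cycle_count n p j = card {cyc p x | x. x < n \<and> card (cyc p x) = j}"

definition conj_class :: "nat \<Rightarrow> (nat \<Rightarrow> nat) \<Rightarrow> (nat \<Rightarrow> nat) set" where
  "conj_class n c = {p. p permutes {..<n} \<and> (\<forall>j\<ge>1. cycle_count n p j = c j)}"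

text \<open>orbit of x under the group generated by p and q (finite permutations, so the
  reflexive-transitive closure of the two maps gives the group orbit)\<close>
definition gorbit :: "(nat \<Rightarrow> nat) \<Rightarrow> (nat \<Rightarrow> nat) \<Rightarrow> nat \<Rightarrow> nat set" where
  "gorbit p q x = {y. (x, y) \<in> ({(a, p a) | a. True} \<union> {(a, q a) | a. True})\<^sup>*}"

definition small_orbits :: "nat \<Rightarrow> (nat \<Rightarrow> nat) \<Rightarrow> (nat \<Rightarrow> nat) \<Rightarrow> nat" where
  "small_orbits n p q =
     card {B. \<exists>x<n. B = gorbit p q x \<and> 1 \<le> card B \<and> 2 * card B \<le> n}"

definition EN :: "nat \<Rightarrow> (nat \<Rightarrow> nat) \<Rightarrow> (nat \<Rightarrow> nat) \<Rightarrow> real" where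
  "EN n c c' = measure_pmf.expectation
      (pair_pmf (pmf_of_set (conj_class n c)) (pmf_of_set (conj_class n c')))
      (\<lambda>(p, q). real (small_orbits n p q))"

end

theory Submission
  imports Defs "HOL-Combinatorics.Cycles" "HOL-Real_Asymp.Real_Asymp"
begin

text \<open>An orbit is in particular a set invariant under both permutations. By conjugation symmetry the
  expected number of common invariant \<open>k\<close>-sets is \<open>f k * f' k / (n choose k)\<close>, where \<open>f k\<close> and
  \<open>f' k\<close> count the invariant \<open>k\<close>-sets of an element of either class. The generating function of
  \<open>f\<close> is \<open>\<Prod>j. (1 + x ^ j) ^ c j\<close>, and since \<open>1 + x ^ j \<le> (1 + x ^ 3) powr (j / 3)\<close> for \<open>j \<ge> 3\<close>
  it is controlled by the numbers of fixed points and 2-cycles alone. Evaluating the two generating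
  functions at points \<open>x\<close> and \<open>y\<close> with \<open>x * y = k / (n - k)\<close> bounds the expected number by
  \<open>M * k * exp (- \<epsilon> * k / 18)\<close> uniformly in \<open>n\<close>, which is summable. Under the stronger hypotheses
  the term for each fixed \<open>k\<close> moreover tends to \<open>0\<close>, and dominated convergence applies.\<close>

section \<open>Cycles and invariant sets\<close>

definition cycles :: "nat \<Rightarrow> (nat \<Rightarrow> nat) \<Rightarrow> nat set set" where
  "cycles n p = cyc p ` {..<n}"

definition invariant_sets :: "nat \<Rightarrow> (nat \<Rightarrow> nat) \<Rightarrow> nat \<Rightarrow> nat set set" where
  "invariant_sets n p k = {B. B \<subseteq> {..<n} \<and> card B = k \<and> p ` B = B}"

lemma self_in_cyc: "x \<in> cyc p x"
  unfolding cyc_def by (rule CollectI, rule exI[of _ 0]) simp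

lemma cyc_subset_of_closed:
  assumes "x \<in> B" "p ` B \<subseteq> B"
  shows "cyc p x \<subseteq> B"
proof -
  have "(p ^^ k) x \<in> B" for k
    by (induction k) (use assms in auto)
  then show ?thesis
    by (auto simp: cyc_def)
qed

lemma image_cyc_subset: "p ` cyc p x \<subseteq> cyc p x"
proof
  fix y assume "y \<in> p ` cyc p x"
  then obtain k where "y = (p ^^ Suc k) x"
    by (auto simp: cyc_def)
  then show "y \<in> cyc p x"
    unfolding cyc_def by blast
qed

lemma cyc_subset: "y \<in> cyc p x \<Longrightarrow> cyc p y \<subseteq> cyc p x"
  using cyc_subset_of_closed image_cyc_subset by metis

text \<open>Since \<open>cyc\<close> collects forward iterates only, symmetry needs finiteness: some
  positive power \<open>p ^^ m\<close> is the identity, so iterating further from \<open>y\<close>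
  leads back to \<open>x\<close>.\<close>

lemma cyc_eq:
  assumes "p permutes {..<n}" and y: "y \<in> cyc p x"
  shows "cyc p y = cyc p x"
proof
  show "cyc p y \<subseteq> cyc p x"
    using y by (rule cyc_subset)
  obtain m where m: "p ^^ m = id" "m > 0"
    using permutation_is_nilpotent[of p] assms(1) permutes_imp_permutation by blast
  obtain i where i: "y = (p ^^ i) x"
    using y by (auto simp: cyc_def)
  \<comment> \<open>These steps complete \<open>m * i\<close> in total, a multiple of
    \<open>m\<close>; as \<open>m > 0\<close>, the subtraction does not truncate.\<close>
  have "(p ^^ (m * i - i)) y = (p ^^ (m * i - i + i)) x"
    by (simp add: i funpow_add)
  also have "m * i - i + i = m * i"
    using m(2) by simp
  also have "(p ^^ (m * i)) x = x"
    by (simp add: m(1) flip: funpow_mult)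
  finally have "x \<in> cyc p y"
    unfolding cyc_def by (metis (mono_tags, lifting) mem_Collect_eq)
  then show "cyc p x \<subseteq> cyc p y"
    by (rule cyc_subset)
qed

lemma cyc_subset_lessThan: "p permutes {..<n} \<Longrightarrow> x < n \<Longrightarrow> cyc p x \<subseteq> {..<n}"
  by (rule cyc_subset_of_closed) (auto simp: permutes_image)

lemma cycles_disjoint:
  assumes "p permutes {..<n}" "A \<in> cycles n p" "B \<in> cycles n p" "A \<noteq> B"
  shows "A \<inter> B = {}"
  using assms cyc_eq unfolding cycles_def by (smt (verit, best) disjoint_iff imageE)

lemma finite_cycles [simp]: "finite (cycles n p)"
  by (simp add: cycles_def)

lemma finite_cycle: "p permutes {..<n} \<Longrightarrow> A \<in> cycles n p \<Longrightarrow> finite A"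
  unfolding cycles_def using cyc_subset_lessThan finite_subset by (metis finite_lessThan imageE lessThan_iff)

lemma card_cycle_pos:
  assumes "p permutes {..<n}" "A \<in> cycles n p"
  shows "card A \<ge> 1"
  using assms finite_cycle[OF assms] self_in_cyc unfolding cycles_def
  by (metis One_nat_def Suc_leI card_gt_0_iff empty_iff imageE)

lemma Union_cycles: "p permutes {..<n} \<Longrightarrow> \<Union>(cycles n p) = {..<n}"
  unfolding cycles_def using cyc_subset_lessThan self_in_cyc by fastforce

lemma sum_card_cycles:
  assumes "p permutes {..<n}"
  shows "(\<Sum>A\<in>cycles n p. card A) = n"
proof -
  have "(\<Sum>A\<in>cycles n p. card A) = card (\<Union>(cycles n p))"
    by (rule card_Union_disjoint[symmetric])
      (use assms cycles_disjoint finite_cycle in \<open>auto simp: pairwise_def disjnt_def\<close>)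
  then show ?thesis
    by (simp add: Union_cycles assms)
qed

lemma cycle_count_eq: "cycle_count n p j = card {A \<in> cycles n p. card A = j}"
  unfolding cycle_count_def cycles_def by (rule arg_cong[of _ _ card]) auto

text \<open>An invariant set contains the whole cycle of each of its points. Hence the cycles inside
  \<open>B\<close> determine \<open>B\<close>, which makes the passage to families of cycles
  injective.\<close>

lemma invariant_set_Union:
  assumes "B \<in> invariant_sets n p k"
  shows "\<Union>{A \<in> cycles n p. A \<subseteq> B} = B"
proof -
  have "cyc p x \<in> cycles n p" "cyc p x \<subseteq> B" if "x \<in> B" for x
    using assms that cyc_subset_of_closed[of x B p] by (auto simp: invariant_sets_def cycles_def)
  then show ?thesis
    using self_in_cyc by blast
qed

text \<open>An invariant set is a union of cycles, so the polynomial
  \<open>\<Prod>A. 1 + x ^ card A\<close> over the cycles is the generating function of the invariant sets.\<close>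

lemma card_invariant_sets_power_le:
  fixes x :: real
  assumes p: "p permutes {..<n}" and x: "x \<ge> 0"
  shows "real (card (invariant_sets n p k)) * x ^ k \<le> (\<Prod>A\<in>cycles n p. 1 + x ^ card A)"
proof -
  let ?f = "\<lambda>B. {A \<in> cycles n p. A \<subseteq> B}"
  have inj: "inj_on ?f (invariant_sets n p k)"
    by (rule inj_on_inverseI[of _ Union]) (rule invariant_set_Union)
  have val: "(\<Prod>A\<in>?f B. x ^ card A) = x ^ k" if B: "B \<in> invariant_sets n p k" for B
  proof -
    have "(\<Sum>A\<in>?f B. card A) = card (\<Union>(?f B))"
      by (rule card_Union_disjoint[symmetric])
        (use p cycles_disjoint finite_cycle in \<open>auto simp: pairwise_def disjnt_def\<close>)
    also have "\<dots> = k"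
      using B by (simp only: invariant_set_Union) (simp add: invariant_sets_def)
    finally show ?thesis
      by (simp add: power_sum[symmetric])
  qed
  have "real (card (invariant_sets n p k)) * x ^ k = (\<Sum>B\<in>invariant_sets n p k. \<Prod>A\<in>?f B. x ^ card A)"
    by (simp add: val)
  also have "\<dots> = (\<Sum>S\<in>?f ` invariant_sets n p k. \<Prod>A\<in>S. x ^ card A)"
    by (simp add: sum.reindex[OF inj])
  \<comment> \<open>Families of cycles of total size other than \<open>k\<close> enter here; their
    terms are nonnegative because \<open>x >= 0\<close>.\<close>
  also have "\<dots> \<le> (\<Sum>S\<in>Pow (cycles n p). \<Prod>A\<in>S. x ^ card A)"
    by (rule sum_mono2) (use x in \<open>auto intro!: prod_nonneg\<close>)
  also have "\<dots> = (\<Prod>A\<in>cycles n p. x ^ card A + 1)"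
    by (subst prod_add) simp_all
  finally show ?thesis
    by (simp add: add.commute)
qed

section \<open>Bounding the generating function by fixed points and 2-cycles\<close>

text \<open>Superadditivity of the power \<open>q = j / 3 >= 1\<close>: with
  \<open>a = x ^ 3\<close>, write \<open>a powr q = a * a powr (q - 1)\<close> and bound both
  \<open>1\<close> and the last factor by \<open>(1 + a) powr (q - 1)\<close>.\<close>

lemma ln_one_plus_power_le:
  fixes x :: real
  assumes "x > 0" "j \<ge> 3"
  shows "ln (1 + x ^ j) \<le> real j / 3 * ln (1 + x ^ 3)"
proof -
  let ?q = "real j / 3"
  have pos: "0 < 1 + x ^ 3" "0 < 1 + x ^ j"
    using assms by (simp_all add: add_pos_pos)
  have "x ^ j = (x ^ 3) powr ?q"
  proof -
    have "(x ^ 3) powr ?q = (x powr 3) powr ?q"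
      using assms(1) powr_realpow[of x 3] by simp
    also have "\<dots> = x powr real j"
      by (simp only: powr_powr) simp
    finally show ?thesis
      using assms(1) by (simp add: powr_realpow)
  qed
  also have "\<dots> = x ^ 3 * (x ^ 3) powr (?q - 1)"
    using assms by (simp add: powr_mult_base)
  also have "\<dots> \<le> x ^ 3 * (1 + x ^ 3) powr (?q - 1)"
    using assms by (intro mult_left_mono powr_mono2) auto
  finally have "1 + x ^ j \<le> (1 + x ^ 3) powr (?q - 1) + x ^ 3 * (1 + x ^ 3) powr (?q - 1)"
    using assms by (intro add_mono ge_one_powr_ge_zero) auto
  also have "\<dots> = (1 + x ^ 3) * (1 + x ^ 3) powr (?q - 1)"
    by (simp add: algebra_simps)
  also have "\<dots> = (1 + x ^ 3) powr ?q"
    using pos by (simp add: powr_mult_base)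
  finally have "ln (1 + x ^ j) \<le> ln ((1 + x ^ 3) powr ?q)"
    using pos by (subst ln_le_cancel_iff) auto
  also have "\<dots> = ?q * ln (1 + x ^ 3)"
    using pos by (subst ln_powr) auto
  finally show ?thesis .
qed

text \<open>Logarithm of a majorant of the generating function: the points on longer cycles are
  treated as if they formed 3-cycles, possibly a fractional number of them.\<close>

definition cycle_exponent :: "nat \<Rightarrow> (nat \<Rightarrow> nat) \<Rightarrow> real \<Rightarrow> real" where
  "cycle_exponent n c x = real (c 1) * ln (1 + x) + real (c 2) * ln (1 + x\<^sup>2)
     + (real n - real (c 1) - 2 * real (c 2)) / 3 * ln (1 + x ^ 3)"

lemma conj_classD:
  assumes "p \<in> conj_class n c"
  shows "p permutes {..<n}" "card {A \<in> cycles n p. card A = 1} = c 1"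
    "card {A \<in> cycles n p. card A = 2} = c 2"
  using assms by (auto simp: conj_class_def cycle_count_eq)

lemma sum_small_cycles_split:
  fixes g :: "nat \<Rightarrow> real"
  assumes "p \<in> conj_class n c"
  shows "(\<Sum>A\<in>cycles n p. g (card A)) =
    real (c 1) * g 1 + real (c 2) * g 2 + (\<Sum>A\<in>{A \<in> cycles n p. card A \<ge> 3}. g (card A))"
proof -
  note P = conj_classD[OF assms]
  let ?C = "\<lambda>j. {A \<in> cycles n p. card A = j}" and ?D = "{A \<in> cycles n p. card A \<ge> 3}"
  have "cycles n p = ?C 1 \<union> (?C 2 \<union> ?D)"
    using card_cycle_pos[OF P(1)] by fastforce
  then have "(\<Sum>A\<in>cycles n p. g (card A)) = (\<Sum>A\<in>?C 1 \<union> (?C 2 \<union> ?D). g (card A))"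
    by simp
  also have "\<dots> = (\<Sum>A\<in>?C 1. g (card A)) + (\<Sum>A\<in>?C 2 \<union> ?D. g (card A))"
    by (rule sum.union_disjoint) auto
  also have "(\<Sum>A\<in>?C 2 \<union> ?D. g (card A)) = (\<Sum>A\<in>?C 2. g (card A)) + (\<Sum>A\<in>?D. g (card A))"
    by (rule sum.union_disjoint) auto
  also have "(\<Sum>A\<in>?C 1. g (card A)) = real (c 1) * g 1"
    using P(2) by simp
  also have "(\<Sum>A\<in>?C 2. g (card A)) = real (c 2) * g 2"
    using P(3) by simp
  finally show ?thesis
    by simp
qed

lemma sum_long_cycles:
  assumes "p \<in> conj_class n c"
  shows "(\<Sum>A\<in>{A \<in> cycles n p. card A \<ge> 3}. real (card A)) = real n - real (c 1) - 2 * real (c 2)"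
proof -
  have "(\<Sum>A\<in>cycles n p. real (card A)) = real n"
    using sum_card_cycles[OF conj_classD(1)[OF assms]] by (metis of_nat_sum)
  then show ?thesis
    using sum_small_cycles_split[OF assms, of real] by simp
qed

lemma fixed_points_and_2_cycles_le:
  assumes "conj_class n c \<noteq> {}"
  shows "real (c 1) + 2 * real (c 2) \<le> real n"
proof -
  obtain p where "p \<in> conj_class n c"
    using assms by blast
  from sum_long_cycles[OF this] show ?thesis
    using sum_nonneg[of "{A \<in> cycles n p. card A \<ge> 3}" "\<lambda>A. real (card A)"] by simp
qed

text \<open>A coefficient of a polynomial with nonnegative coefficients is at most the value at
  \<open>x\<close> divided by \<open>x ^ k\<close>. The point \<open>x\<close> stays free, to be
  chosen later.\<close>

lemma card_invariant_sets_le: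
  fixes x :: real
  assumes p: "p \<in> conj_class n c" and x: "x > 0"
  shows "real (card (invariant_sets n p k)) \<le> exp (cycle_exponent n c x) / x ^ k"
proof -
  note P = conj_classD[OF p]
  let ?D = "{A \<in> cycles n p. card A \<ge> 3}"
  have pos: "0 < 1 + x ^ j" for j
    using x by (simp add: add_pos_pos)
  have "(\<Sum>A\<in>?D. ln (1 + x ^ card A)) \<le> (\<Sum>A\<in>?D. real (card A) / 3 * ln (1 + x ^ 3))"
    by (rule sum_mono) (use x ln_one_plus_power_le in auto)
  also have "\<dots> = (\<Sum>A\<in>?D. real (card A)) / 3 * ln (1 + x ^ 3)"
    by (simp only: sum_distrib_right sum_divide_distrib)
  finally have "(\<Sum>A\<in>cycles n p. ln (1 + x ^ card A)) \<le> cycle_exponent n c x"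
    unfolding cycle_exponent_def sum_long_cycles[OF p]
      sum_small_cycles_split[OF p, of "\<lambda>j. ln (1 + x ^ j)"] by simp
  moreover have "(\<Prod>A\<in>cycles n p. 1 + x ^ card A) = exp (\<Sum>A\<in>cycles n p. ln (1 + x ^ card A))"
    using pos by (simp add: exp_sum)
  ultimately have "(\<Prod>A\<in>cycles n p. 1 + x ^ card A) \<le> exp (cycle_exponent n c x)"
    by simp
  then have "real (card (invariant_sets n p k)) * x ^ k \<le> exp (cycle_exponent n c x)"
    using card_invariant_sets_power_le[OF P(1), of x k] x by linarith
  then show ?thesis
    using x by (simp add: field_simps)
qed

section \<open>Averaging over conjugacy classes\<close>

text \<open>Conjugation by \<open>s\<close> carries each cycle to its image under \<open>s\<close>,
  so the number of cycles of each length survives.\<close>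

lemma conj_conj_class:
  assumes p: "p \<in> conj_class n c" and s: "s permutes {..<n}"
  shows "s \<circ> p \<circ> inv s \<in> conj_class n c"
proof -
  let ?p = "s \<circ> p \<circ> inv s"
  have inv: "inv s (s x) = x" "s (inv s x) = x" for x
    using permutes_inverses[OF s] by auto
  have "?p permutes {..<n}"
    using conj_classD(1)[OF p] s by (intro permutes_compose permutes_inv)
  have "(?p ^^ k) (s x) = s ((p ^^ k) x)" for k x
    by (induction k) (simp_all add: inv)
  then have cyc: "cyc ?p (s x) = s ` cyc p x" for x
    unfolding cyc_def by auto
  have "cycle_count n ?p j = cycle_count n p j" for j
  proof -
    have "{cyc ?p x | x. x < n \<and> card (cyc ?p x) = j} = {cyc ?p (s x) | x. x < n \<and> card (cyc ?p (s x)) = j}"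
    proof (intro equalityI subsetI)
      fix A assume "A \<in> {cyc ?p x | x. x < n \<and> card (cyc ?p x) = j}"
      then obtain x where x: "A = cyc ?p x" "x < n" "card (cyc ?p x) = j"
        by blast
      have "inv s x < n"
        using permutes_in_image[OF permutes_inv[OF s]] x(2) by simp
      then show "A \<in> {cyc ?p (s x) | x. x < n \<and> card (cyc ?p (s x)) = j}"
        using x inv(2)[of x] by (intro CollectI exI[of _ "inv s x"]) simp
    next
      fix A assume "A \<in> {cyc ?p (s x) | x. x < n \<and> card (cyc ?p (s x)) = j}"
      then obtain x where x: "A = cyc ?p (s x)" "x < n" "card (cyc ?p (s x)) = j"
        by blast
      have "s x < n"
        using permutes_in_image[OF s] x(2) by simp
      then show "A \<in> {cyc ?p x | x. x < n \<and> card (cyc ?p x) = j}"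
        using x(1,3) by blast
    qed
    also have "\<dots> = (`) s ` {cyc p x | x. x < n \<and> card (cyc p x) = j}"
      unfolding cyc using permutes_inj[OF s] by (auto simp: card_image inj_on_subset)
    also have "card \<dots> = card {cyc p x | x. x < n \<and> card (cyc p x) = j}"
      by (rule card_image) (use permutes_inj[OF s] in \<open>auto intro: inj_on_subset[OF inj_on_image] simp: inj_image_eq_iff inj_on_def\<close>)
    finally show ?thesis
      by (simp only: cycle_count_def)
  qed
  then show ?thesis
    using p \<open>?p permutes {..<n}\<close> by (simp add: conj_class_def)
qed

text \<open>A bijection from \<open>A\<close> to \<open>B\<close> is glued to one between the
  complements, which have equal size too.\<close>

lemma ex_permutes_image_eq:
  assumes "finite S" "A \<subseteq> S" "B \<subseteq> S" "card A = card B"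
  shows "\<exists>s. s permutes S \<and> s ` A = B"
proof -
  have fin: "finite A" "finite B"
    using assms finite_subset by auto
  obtain f where f: "bij_betw f A B"
    using finite_same_card_bij[OF fin assms(4)] by blast
  have "card (S - A) = card (S - B)"
    using assms fin by (simp add: card_Diff_subset)
  then obtain g where g: "bij_betw g (S - A) (S - B)"
    using finite_same_card_bij[of "S - A" "S - B"] assms(1) by blast
  define s where "s = (\<lambda>x. if x \<in> A then f x else if x \<in> S then g x else x)"
  have "bij_betw s A B"
    using f by (subst bij_betw_cong[of _ _ f]) (auto simp: s_def)
  moreover have "bij_betw s (S - A) (S - B)"
    using g by (subst bij_betw_cong[of _ _ g]) (auto simp: s_def)
  ultimately have "bij_betw s (A \<union> (S - A)) (B \<union> (S - B))"
    by (rule bij_betw_combine) auto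
  then have "s permutes S"
    using assms(2,3) by (intro bij_imp_permutes) (auto simp: s_def Un_absorb1)
  moreover have "s ` A = B"
    using \<open>bij_betw s A B\<close> by (simp add: bij_betw_imp_surj_on)
  ultimately show ?thesis
    by blast
qed

lemma finite_conj_class [simp]: "finite (conj_class n c)"
  by (rule finite_subset[OF _ finite_permutations[of "{..<n}"]]) (auto simp: conj_class_def)

text \<open>Conjugation by a permutation taking \<open>A\<close> to \<open>B\<close> turns elements
  that preserve \<open>A\<close> injectively into elements that preserve \<open>B\<close>.\<close>

lemma card_stabilizer_le:
  assumes "A \<subseteq> {..<n}" "B \<subseteq> {..<n}" "card A = card B"
  shows "card {p \<in> conj_class n c. p ` A = A} \<le> card {p \<in> conj_class n c. p ` B = B}"
proof -
  obtain s where s: "s permutes {..<n}" "s ` A = B"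
    using ex_permutes_image_eq[of "{..<n}" A B] assms by auto
  have inv: "inv s (s x) = x" "s (inv s x) = x" for x
    using permutes_inverses[OF s(1)] by auto
  show ?thesis
  proof (rule card_inj_on_le[where f = "\<lambda>p. s \<circ> p \<circ> inv s"])
    show "inj_on (\<lambda>p. s \<circ> p \<circ> inv s) {p \<in> conj_class n c. p ` A = A}"
    proof (rule inj_on_inverseI[where g = "\<lambda>p. inv s \<circ> p \<circ> s"])
    qed (auto simp: fun_eq_iff inv)
    have "(s \<circ> p \<circ> inv s) ` B = s ` p ` A" for p
      unfolding s(2)[symmetric] by (simp add: image_image inv)
    then show "(\<lambda>p. s \<circ> p \<circ> inv s) ` {p \<in> conj_class n c. p ` A = A} \<subseteq> {p \<in> conj_class n c. p ` B = B}"
      using conj_conj_class[OF _ s(1)] s(2) by (intro subsetI) (elim imageE CollectE conjE, simp)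
  qed simp
qed

lemma card_stabilizer_eq:
  assumes "A \<subseteq> {..<n}" "B \<subseteq> {..<n}" "card A = card B"
  shows "card {p \<in> conj_class n c. p ` A = A} = card {p \<in> conj_class n c. p ` B = B}"
  by (rule order_antisym; rule card_stabilizer_le) (simp_all add: assms)

lemma finite_invariant_sets [simp]: "finite (invariant_sets n p k)"
  by (rule finite_subset[of _ "Pow {..<n}"]) (auto simp: invariant_sets_def)

text \<open>Double counting of pairs of a permutation and a \<open>k\<close>-set that it
  preserves.\<close>

lemma sum_card_invariant_sets:
  "(\<Sum>p\<in>conj_class n c. card (invariant_sets n p k)) =
    (\<Sum>B | B \<subseteq> {..<n} \<and> card B = k. card {p \<in> conj_class n c. p ` B = B})"
proof -
  let ?K = "{B. B \<subseteq> {..<n} \<and> card B = k}"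
  have fin: "finite ?K"
    by (rule finite_subset[of _ "Pow {..<n}"]) auto
  have "card (invariant_sets n p k) = (\<Sum>B\<in>?K. if p ` B = B then 1 else 0)" for p
  proof -
    have "invariant_sets n p k = {B \<in> ?K. p ` B = B}"
      by (auto simp: invariant_sets_def)
    then show ?thesis
      using fin by (simp add: sum.If_cases Int_def)
  qed
  moreover have "card {p \<in> conj_class n c. p ` B = B} = (\<Sum>p\<in>conj_class n c. if p ` B = B then 1 else 0)" for B
    by (simp add: sum.If_cases Int_def)
  ultimately show ?thesis
    by (simp add: sum.swap[of _ "conj_class n c" ?K])
qed

text \<open>Double counting again: for a fixed \<open>B\<close> the conditions on \<open>p\<close>
  and on \<open>q\<close> are independent, so the count of pairs factors.\<close>

lemma sum_card_common_invariant_sets: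
  "(\<Sum>p\<in>conj_class n c. \<Sum>q\<in>conj_class n c'. card (invariant_sets n p k \<inter> invariant_sets n q k)) =
    (\<Sum>B | B \<subseteq> {..<n} \<and> card B = k.
      card {p \<in> conj_class n c. p ` B = B} * card {p \<in> conj_class n c'. p ` B = B})"
proof -
  let ?K = "{B. B \<subseteq> {..<n} \<and> card B = k}" and ?C = "conj_class n c" and ?C' = "conj_class n c'"
  let ?i = "\<lambda>p B. if p ` B = B then 1 else 0 :: nat"
  have fin: "finite ?K"
    by (rule finite_subset[of _ "Pow {..<n}"]) auto
  have stab: "card {p \<in> conj_class n c. p ` B = B} = (\<Sum>p\<in>conj_class n c. ?i p B)" for B c
    by (simp add: sum.If_cases Int_def)
  have "card (invariant_sets n p k \<inter> invariant_sets n q k) = (\<Sum>B\<in>?K. ?i p B * ?i q B)" for p q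
  proof -
    have "invariant_sets n p k \<inter> invariant_sets n q k = {B \<in> ?K. p ` B = B \<and> q ` B = B}"
      by (auto simp: invariant_sets_def)
    moreover have "?i p B * ?i q B = (if p ` B = B \<and> q ` B = B then 1 else 0)" for B
      by simp
    ultimately show ?thesis
      using fin by (simp add: sum.If_cases Int_def)
  qed
  then have "(\<Sum>p\<in>?C. \<Sum>q\<in>?C'. card (invariant_sets n p k \<inter> invariant_sets n q k)) =
      (\<Sum>p\<in>?C. \<Sum>B\<in>?K. \<Sum>q\<in>?C'. ?i p B * ?i q B)"
    by (simp only: sum.swap[of _ ?C' ?K])
  also have "\<dots> = (\<Sum>B\<in>?K. \<Sum>p\<in>?C. \<Sum>q\<in>?C'. ?i p B * ?i q B)"
    by (rule sum.swap)
  also have "\<dots> = (\<Sum>B\<in>?K. card {p \<in> ?C. p ` B = B} * card {p \<in> ?C'. p ` B = B})"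
    by (simp only: stab sum_product)
  finally show ?thesis .
qed

definition expected_invariant :: "nat \<Rightarrow> (nat \<Rightarrow> nat) \<Rightarrow> (nat \<Rightarrow> nat) \<Rightarrow> nat \<Rightarrow> real" where
  "expected_invariant n c c' k =
    real (\<Sum>p\<in>conj_class n c. \<Sum>q\<in>conj_class n c'. card (invariant_sets n p k \<inter> invariant_sets n q k))
      / (real (card (conj_class n c)) * real (card (conj_class n c')))"

text \<open>By symmetry all \<open>k\<close>-sets are preserved by equally many elements of the
  class, so the left side counts the pairs of an element and an invariant
  \<open>k\<close>-set.\<close>

lemma card_stabilizer_bound:
  assumes B: "B \<subseteq> {..<n}" "card B = k"
    and F: "\<And>p. p \<in> conj_class n c \<Longrightarrow> real (card (invariant_sets n p k)) \<le> F"
  shows "real (n choose k) * real (card {p \<in> conj_class n c. p ` B = B}) \<le> real (card (conj_class n c)) * F"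
proof -
  let ?K = "{B. B \<subseteq> {..<n} \<and> card B = k}"
  have "(n choose k) * card {p \<in> conj_class n c. p ` B = B} = (\<Sum>A\<in>?K. card {p \<in> conj_class n c. p ` B = B})"
    by (simp add: n_subsets)
  also have "\<dots> = (\<Sum>A\<in>?K. card {p \<in> conj_class n c. p ` A = A})"
    by (intro sum.cong refl card_stabilizer_eq) (use B in auto)
  also have "\<dots> = (\<Sum>p\<in>conj_class n c. card (invariant_sets n p k))"
    by (rule sum_card_invariant_sets[symmetric])
  finally have "real ((n choose k) * card {p \<in> conj_class n c. p ` B = B}) =
      real (\<Sum>p\<in>conj_class n c. card (invariant_sets n p k))"
    by (rule arg_cong)
  then have "real (n choose k) * real (card {p \<in> conj_class n c. p ` B = B}) =
      (\<Sum>p\<in>conj_class n c. real (card (invariant_sets n p k)))"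
    by (simp only: of_nat_mult of_nat_sum)
  also have "\<dots> \<le> real (card (conj_class n c)) * F"
    by (rule sum_bounded_above) (rule F)
  finally show ?thesis .
qed

text \<open>With \<open>b = n choose k\<close>, each of the \<open>b\<close> sets is preserved by a
  random \<open>p\<close> with probability at most \<open>F / b\<close> and by \<open>q\<close> with
  probability at most \<open>F' / b\<close>.\<close>

lemma expected_invariant_le_of_bounds:
  assumes ne: "conj_class n c \<noteq> {}" "conj_class n c' \<noteq> {}" and "k \<le> n"
    and F: "\<And>p. p \<in> conj_class n c \<Longrightarrow> real (card (invariant_sets n p k)) \<le> F"
    and F': "\<And>p. p \<in> conj_class n c' \<Longrightarrow> real (card (invariant_sets n p k)) \<le> F'"
  shows "expected_invariant n c c' k \<le> F * F' / real (n choose k)"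
proof -
  let ?K = "{B. B \<subseteq> {..<n} \<and> card B = k}"
  let ?a = "\<lambda>c B. real (card {p \<in> conj_class n c. p ` B = B})"
  define b where "b = real (n choose k)"
  define C where "C = real (card (conj_class n c))"
  define C' where "C' = real (card (conj_class n c'))"
  have b: "b > 0" and C: "C > 0" "C' > 0"
    using assms by (auto simp: b_def C_def C'_def card_gt_0_iff)
  have "0 \<le> F"
    using ne(1) F by (meson all_not_in_conv of_nat_0_le_iff order_trans)
  have "(\<Sum>B\<in>?K. ?a c B * ?a c' B) \<le> real (card ?K) * ((C * F / b) * (C' * F' / b))"
  proof (rule sum_bounded_above)
    fix B assume B: "B \<in> ?K"
    show "?a c B * ?a c' B \<le> (C * F / b) * (C' * F' / b)"
    proof (rule mult_mono)
      show "?a c B \<le> C * F / b"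
        using card_stabilizer_bound[of B n k c F] B F b by (simp add: b_def C_def field_simps)
      show "?a c' B \<le> C' * F' / b"
        using card_stabilizer_bound[of B n k c' F'] B F' b by (simp add: b_def C'_def field_simps)
    qed (use b C \<open>0 \<le> F\<close> in auto)
  qed
  also have "\<dots> = C * C' * (F * F' / b)"
    using b by (simp add: n_subsets flip: b_def)
  finally show ?thesis
    unfolding expected_invariant_def sum_card_common_invariant_sets C_def[symmetric] C'_def[symmetric] b_def[symmetric]
    using C by (simp add: divide_le_eq mult.commute)
qed

lemma expected_invariant_nonneg: "0 \<le> expected_invariant n c c' k"
  unfolding expected_invariant_def by (intro divide_nonneg_nonneg mult_nonneg_nonneg) (simp_all only: of_nat_0_le_iff)

lemma expected_invariant_le:
  fixes x y :: real
  assumes "conj_class n c \<noteq> {}" "conj_class n c' \<noteq> {}" "k \<le> n" "x > 0" "y > 0"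
  shows "expected_invariant n c c' k
    \<le> exp (cycle_exponent n c x + cycle_exponent n c' y) / (x * y) ^ k * (1 / real (n choose k))"
proof -
  have "expected_invariant n c c' k
      \<le> (exp (cycle_exponent n c x) / x ^ k) * (exp (cycle_exponent n c' y) / y ^ k) / real (n choose k)"
    by (rule expected_invariant_le_of_bounds) (use assms card_invariant_sets_le in auto)
  then show ?thesis
    by (simp add: exp_add power_mult_distrib)
qed

section \<open>From small orbits to common invariant sets\<close>

lemma gorbit_closed: "y \<in> gorbit p q x \<Longrightarrow> p y \<in> gorbit p q x \<and> q y \<in> gorbit p q x"
  unfolding gorbit_def by (auto intro: rtrancl_into_rtrancl)

lemma gorbit_subset:
  assumes "p ` S \<subseteq> S" "q ` S \<subseteq> S" "x \<in> S"
  shows "gorbit p q x \<subseteq> S"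
proof
  fix y assume "y \<in> gorbit p q x"
  then have "(x, y) \<in> ({(a, p a) | a. True} \<union> {(a, q a) | a. True})\<^sup>*"
    by (simp add: gorbit_def)
  then show "y \<in> S"
    by induction (use assms in auto)
qed

text \<open>Closure gives only an inclusion; equality follows because an injective self-map of a
  finite set is onto.\<close>

lemma gorbit_invariant:
  assumes p: "p permutes {..<n}" and q: "q permutes {..<n}" and x: "x < n"
  shows "gorbit p q x \<in> invariant_sets n p (card (gorbit p q x)) \<inter> invariant_sets n q (card (gorbit p q x))"
proof -
  let ?B = "gorbit p q x"
  have sub: "?B \<subseteq> {..<n}"
    by (rule gorbit_subset) (use x permutes_image[OF p] permutes_image[OF q] in auto)
  then have fin: "finite ?B"
    using finite_subset by blast
  have "p ` ?B = ?B"
    by (rule endo_inj_surj[OF fin]) (use gorbit_closed permutes_inj_on[OF p] in blast)+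
  moreover have "q ` ?B = ?B"
    by (rule endo_inj_surj[OF fin]) (use gorbit_closed permutes_inj_on[OF q] in blast)+
  ultimately show ?thesis
    using sub by (simp add: invariant_sets_def)
qed

text \<open>Distinct small orbits are distinct common invariant sets, which are then sorted by
  size.\<close>

lemma small_orbits_le:
  assumes "p permutes {..<n}" "q permutes {..<n}"
  shows "small_orbits n p q \<le> (\<Sum>k = 1..n div 2. card (invariant_sets n p k \<inter> invariant_sets n q k))"
proof -
  let ?I = "\<lambda>k. invariant_sets n p k \<inter> invariant_sets n q k"
  have "small_orbits n p q \<le> card (\<Union>k\<in>{1..n div 2}. ?I k)"
    unfolding small_orbits_def
  proof (rule card_mono)
    show "{B. \<exists>x<n. B = gorbit p q x \<and> 1 \<le> card B \<and> 2 * card B \<le> n} \<subseteq> (\<Union>k\<in>{1..n div 2}. ?I k)"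
    proof
      fix B assume "B \<in> {B. \<exists>x<n. B = gorbit p q x \<and> 1 \<le> card B \<and> 2 * card B \<le> n}"
      then have "card B \<in> {1..n div 2}" "B \<in> ?I (card B)"
        using gorbit_invariant[OF assms] by auto
      then show "B \<in> (\<Union>k\<in>{1..n div 2}. ?I k)"
        by blast
    qed
  qed simp
  also have "\<dots> \<le> (\<Sum>k = 1..n div 2. card (?I k))"
    by (rule card_UN_le) simp
  finally show ?thesis .
qed

lemma EN_nonneg: "0 \<le> EN n c c'"
  unfolding EN_def by (rule integral_nonneg_AE) (simp add: case_prod_unfold)

lemma EN_le_sum_expected_invariant:
  assumes ne: "conj_class n c \<noteq> {}" "conj_class n c' \<noteq> {}"
  shows "EN n c c' \<le> (\<Sum>k = 1..n div 2. expected_invariant n c c' k)"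
proof -
  let ?C = "conj_class n c" and ?C' = "conj_class n c'"
  let ?D = "real (card ?C) * real (card ?C')"
  \<comment> \<open>Both classes are finite and nonempty, so the expectation is a finite sum with
    constant weight \<open>1 / ?D\<close>.\<close>
  have "EN n c c' = (\<Sum>z\<in>?C \<times> ?C'. (case z of (p, q) \<Rightarrow> real (small_orbits n p q)) *
      pmf (pair_pmf (pmf_of_set ?C) (pmf_of_set ?C')) z)"
    unfolding EN_def by (rule integral_measure_pmf_real) (use ne in auto)
  also have "\<dots> = (\<Sum>(p, q)\<in>?C \<times> ?C'. real (small_orbits n p q) / ?D)"
    by (rule sum.cong) (auto simp: pmf_pair ne)
  also have "\<dots> = (\<Sum>p\<in>?C. \<Sum>q\<in>?C'. real (small_orbits n p q) / ?D)"
    by (rule sum.cartesian_product[symmetric])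
  also have "\<dots> \<le> (\<Sum>p\<in>?C. \<Sum>q\<in>?C'. real (\<Sum>k = 1..n div 2. card (invariant_sets n p k \<inter> invariant_sets n q k)) / ?D)"
    by (intro sum_mono divide_right_mono of_nat_mono small_orbits_le) (auto dest: conj_classD(1))
  also have "\<dots> = (\<Sum>p\<in>?C. \<Sum>k = 1..n div 2. \<Sum>q\<in>?C'. real (card (invariant_sets n p k \<inter> invariant_sets n q k)) / ?D)"
    by (simp only: of_nat_sum sum_divide_distrib sum.swap[of _ ?C'])
  also have "\<dots> = (\<Sum>k = 1..n div 2. \<Sum>p\<in>?C. \<Sum>q\<in>?C'. real (card (invariant_sets n p k \<inter> invariant_sets n q k)) / ?D)"
    by (rule sum.swap)
  also have "\<dots> = (\<Sum>k = 1..n div 2. expected_invariant n c c' k)"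
    by (simp only: expected_invariant_def of_nat_sum sum_divide_distrib)
  finally show ?thesis .
qed

section \<open>Lower bounds for binomial coefficients\<close>

text \<open>Logarithm of the ratio of \<open>fact n\<close> to \<open>(n / e) ^ n\<close>, the
  correction factor in Stirling's formula.\<close>

definition stirling_defect :: "nat \<Rightarrow> real" where
  "stirling_defect n = ln (fact n) + real n - real n * ln (real n)"

lemma stirling_defect_Suc:
  assumes "n \<ge> 1"
  shows "stirling_defect (Suc n) - stirling_defect n = 1 - real n * (ln (real (Suc n)) - ln (real n))"
proof -
  have "ln (fact (Suc n) :: real) = ln (real (Suc n)) + ln (fact n)"
    by (simp only: fact_Suc) (subst ln_mult, auto)
  then show ?thesis
    by (simp add: stirling_defect_def algebra_simps)
qed

lemma stirling_defect_Suc_ge: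
  assumes "n \<ge> 1"
  shows "stirling_defect n \<le> stirling_defect (Suc n)"
proof -
  have "ln (real (Suc n)) - ln (real n) \<le> 1 / real n"
    using ln_diff_le[of "real (Suc n)" "real n"] assms by simp
  then show ?thesis
    using stirling_defect_Suc[OF assms] assms by (simp add: field_simps)
qed

text \<open>This rests on \<open>ln (1 + 1 / n) >= 1 / (n + 1)\<close>, whereas the monotonicity of
  the defect rests on \<open>ln (1 + 1 / n) <= 1 / n\<close>.\<close>

lemma stirling_defect_Suc_le:
  assumes "n \<ge> 1"
  shows "stirling_defect (Suc n) - ln (real (Suc n)) \<le> stirling_defect n - ln (real n)"
proof -
  have "ln (real n) - ln (real (Suc n)) \<le> - (1 / real (Suc n))"
    using ln_diff_le[of "real n" "real (Suc n)"] assms by simp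
  then have "1 \<le> real (Suc n) * (ln (real (Suc n)) - ln (real n))"
    by (simp add: field_simps)
  then show ?thesis
    using stirling_defect_Suc[OF assms] by (simp add: algebra_simps)
qed

lemma stirling_defect_mono:
  assumes "1 \<le> m" "m \<le> n"
  shows "stirling_defect m \<le> stirling_defect n"
  using assms(2)
proof (induction n rule: dec_induct)
  case (step n)
  then show ?case
    using stirling_defect_Suc_ge[of n] assms(1) by linarith
qed simp

lemma stirling_defect_le:
  assumes "1 \<le> n"
  shows "stirling_defect n \<le> 1 + ln (real n)"
proof -
  have "stirling_defect n - ln (real n) \<le> 1"
    using assms
  proof (induction n rule: dec_induct)
    case base
    then show ?case by (simp add: stirling_defect_def)
  next
    case (step n)
    then show ?case using stirling_defect_Suc_le[of n] by linarith
  qed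
  then show ?thesis by simp
qed

text \<open>For this \<open>t\<close> the largest term of the binomial expansion of \<open>(1 + t) ^ n\<close> is the one with
  index \<open>k\<close>; up to the factor \<open>e k\<close> it carries the whole sum.\<close>

lemma inverse_binomial_le:
  fixes t :: real
  assumes k: "1 \<le> k" "k < n" and t: "t = real k / real (n - k)"
  shows "1 / real (n choose k) \<le> exp 1 * real k * t ^ k * exp (- (real n * ln (1 + t)))"
proof -
  define m where "m = n - k"
  have m: "1 \<le> m" "n = m + k" "0 < real m" "0 < real k"
    using k by (auto simp: m_def)
  have t': "t = real k / real m" "0 < t" "1 + t = real n / real m"
  proof -
    show "t = real k / real m"
      by (simp add: t m_def)
    then show "0 < t" "1 + t = real n / real m"
      using m(3,4) by (simp_all add: m(2) add_divide_distrib)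
  qed
  have "real (n choose k) = fact n / (fact k * fact m)"
    unfolding m_def by (rule binomial_fact) (use k in simp)
  then have "ln (real (n choose k)) = ln (fact n :: real) - (ln (fact k) + ln (fact m))"
    by (simp add: ln_div ln_mult)
  also have "\<dots> = stirling_defect n - stirling_defect k - stirling_defect m
      + real n * ln (real n) - real k * ln (real k) - real m * ln (real m)"
    using m(2) by (simp add: stirling_defect_def algebra_simps)
  \<comment> \<open>The defect of \<open>m\<close> is at most that of \<open>n\<close>; the defect
    of \<open>k\<close> costs \<open>1 + ln k\<close>, the origin of the factor
    \<open>exp 1 * real k\<close>.\<close>
  also have "\<dots> \<ge> - (1 + ln (real k)) + real n * ln (real n) - real k * ln (real k) - real m * ln (real m)"
    using stirling_defect_mono[of m n] stirling_defect_le[of k] m k by simp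
  also have "- (1 + ln (real k)) + real n * ln (real n) - real k * ln (real k) - real m * ln (real m) =
      real n * ln (1 + t) - real k * ln t - 1 - ln (real k)"
    using m k by (simp add: t'(3)) (simp add: t'(1) ln_div algebra_simps)
  finally have *: "real n * ln (1 + t) - real k * ln t - 1 - ln (real k) \<le> ln (real (n choose k))" .
  have pos: "0 < real (n choose k)"
    using k by simp
  have "1 / real (n choose k) = exp (- ln (real (n choose k)))"
    using pos by (simp add: exp_minus inverse_eq_divide)
  also have "\<dots> \<le> exp (1 + ln (real k) + real k * ln t + - (real n * ln (1 + t)))"
    using * by simp
  also have "\<dots> = exp 1 * real k * t ^ k * exp (- (real n * ln (1 + t)))"
    using m(4) t'(2) by (simp only: exp_add exp_ln exp_of_nat_mult)
  finally show ?thesis .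
qed

text \<open>This lacks the exponential gain of \<open>inverse_binomial_le\<close> but suffices for
  fixed \<open>k\<close>.\<close>

lemma power_div_le_binomial:
  assumes "1 \<le> k" "k \<le> n"
  shows "1 / real (n choose k) \<le> (real k / real n) ^ k"
proof -
  have "(real n / real k) ^ k \<le> real (n choose k)"
    using binomial_ge_n_over_k_pow_k[of k n, where 'a=real] assms by simp
  moreover have "0 < (real n / real k) ^ k"
    using assms by simp
  ultimately have "1 / real (n choose k) \<le> 1 / (real n / real k) ^ k"
    using assms by (intro divide_left_mono mult_pos_pos) auto
  then show ?thesis
    by (simp add: power_divide)
qed

section \<open>Bounds for the expected number of invariant sets\<close>

text \<open>Each term uses \<open>ln (1 + z) <= z\<close>. The skewed and fixed-\<open>k\<close>
  estimates can afford this loss; the balanced one keeps the logarithm for 2-cycles.\<close>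

lemma cycle_exponent_le:
  fixes x :: real
  assumes "conj_class n c \<noteq> {}" "x > 0"
  shows "cycle_exponent n c x \<le> real (c 1) * x + real (c 2) * x\<^sup>2 + real n * x ^ 3 / 3"
proof -
  note fp = fixed_points_and_2_cycles_le[OF assms(1)]
  have "real (c 1) * ln (1 + x) \<le> real (c 1) * x"
    by (intro mult_left_mono ln_add_one_self_le_self) (use assms(2) in auto)
  moreover have "real (c 2) * ln (1 + x\<^sup>2) \<le> real (c 2) * x\<^sup>2"
    by (intro mult_left_mono ln_add_one_self_le_self) auto
  moreover have "(real n - real (c 1) - 2 * real (c 2)) / 3 * ln (1 + x ^ 3) \<le> real n / 3 * x ^ 3"
    by (intro mult_mono ln_add_one_self_le_self) (use fp assms(2) in auto)
  ultimately show ?thesis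
    unfolding cycle_exponent_def by simp
qed

lemma expected_invariant_commute: "expected_invariant n c c' k = expected_invariant n c' c k"
  unfolding expected_invariant_def sum_card_common_invariant_sets by (simp only: mult.commute)

text \<open>With \<open>x * y = t\<close> the power \<open>(x * y) ^ k\<close> cancels the
  \<open>t ^ k\<close> of the binomial estimate, leaving the two exponents to compete with
  \<open>n * ln (1 + t)\<close>.\<close>

lemma expected_invariant_le_exp:
  fixes x y :: real
  assumes ne: "conj_class n c \<noteq> {}" "conj_class n c' \<noteq> {}" and k: "1 \<le> k" "k < n"
    and xy: "x > 0" "y > 0" "x * y = t" and t: "t = real k / real (n - k)"
    and E: "cycle_exponent n c x + cycle_exponent n c' y - real n * ln (1 + t) \<le> E"
  shows "expected_invariant n c c' k \<le> exp 1 * real k * exp E"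
proof -
  have "t > 0"
    using xy by auto
  let ?e = "cycle_exponent n c x + cycle_exponent n c' y"
  have "expected_invariant n c c' k \<le> exp ?e / t ^ k * (1 / real (n choose k))"
    using expected_invariant_le[OF ne, of k x y] k xy by simp
  also have "\<dots> \<le> exp ?e / t ^ k * (exp 1 * real k * t ^ k * exp (- (real n * ln (1 + t))))"
    by (intro mult_left_mono inverse_binomial_le k t) (use \<open>t > 0\<close> in auto)
  also have "\<dots> = exp 1 * real k * exp (?e - real n * ln (1 + t))"
    using \<open>t > 0\<close> by (simp add: exp_diff exp_minus field_simps)
  also have "\<dots> \<le> exp 1 * real k * exp E"
    using E by (intro mult_left_mono) auto
  finally show ?thesis .
qed

text \<open>Take logarithms in \<open>(1 + w^3)^2 * (1 + w^2 / 2) <= (1 + w^2)^3\<close>, use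
  \<open>ln (1 + w^2 / 2) >= w^2 / 3\<close> and divide by 3. The factor \<open>2 / 3\<close> is the
  share of longer cycles per point in both classes together.\<close>

lemma ln_one_plus_square_minus_cube_ge:
  fixes w :: real
  assumes "0 < w" "w \<le> 1"
  shows "w\<^sup>2 / 9 \<le> ln (1 + w\<^sup>2) - 2 / 3 * ln (1 + w ^ 3)"
proof -
  have w3: "0 \<le> w ^ 3" "w ^ 3 \<le> 1" and w2: "0 \<le> w\<^sup>2" "w\<^sup>2 \<le> 1"
    using assms by (auto intro: power_le_one)
  have pos: "0 < 1 + w\<^sup>2" "0 < 1 + w ^ 3" "0 < 1 + w\<^sup>2 / 2"
    using w2 w3 by linarith+
  have "(1 + w ^ 3)\<^sup>2 \<le> 2\<^sup>2"
    by (rule power_mono) (use w3 in auto)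
  then have "w\<^sup>2 / 2 * (1 + w ^ 3)\<^sup>2 \<le> w\<^sup>2 / 2 * 4"
    using w2(1) by (intro mult_left_mono) auto
  moreover have "0 \<le> w\<^sup>2 * (3 * (w - 1 / 3)\<^sup>2 + 2 / 3)"
    using w2(1) by (intro mult_nonneg_nonneg add_nonneg_nonneg) auto
  \<comment> \<open>The last summand is \<open>w^2 - 2 * w^3 + 3 * w^4\<close> after completing the
    square.\<close>
  moreover have "(1 + w\<^sup>2) ^ 3 = (1 + w ^ 3)\<^sup>2 + w\<^sup>2 / 2 * 4 + w\<^sup>2 * (3 * (w - 1 / 3)\<^sup>2 + 2 / 3)"
    by (simp add: power2_eq_square power3_eq_cube field_simps)
  moreover have "(1 + w ^ 3)\<^sup>2 * (1 + w\<^sup>2 / 2) = (1 + w ^ 3)\<^sup>2 + w\<^sup>2 / 2 * (1 + w ^ 3)\<^sup>2"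
    by (simp add: algebra_simps)
  ultimately have "(1 + w ^ 3)\<^sup>2 * (1 + w\<^sup>2 / 2) \<le> (1 + w\<^sup>2) ^ 3"
    by linarith
  then have "ln ((1 + w ^ 3)\<^sup>2 * (1 + w\<^sup>2 / 2)) \<le> ln ((1 + w\<^sup>2) ^ 3)"
    using pos by (subst ln_le_cancel_iff) auto
  then have "2 * ln (1 + w ^ 3) + ln (1 + w\<^sup>2 / 2) \<le> 3 * ln (1 + w\<^sup>2)"
    using pos by (simp add: ln_mult ln_realpow)
  moreover have "w\<^sup>2 / 3 \<le> (w\<^sup>2 / 2) / (1 + w\<^sup>2 / 2)"
  proof -
    have "w\<^sup>2 * w\<^sup>2 \<le> w\<^sup>2 * 1"
      using w2 by (intro mult_left_mono)
    then show ?thesis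
      using pos by (simp add: field_simps)
  qed
  moreover have "(w\<^sup>2 / 2) / (1 + w\<^sup>2 / 2) \<le> ln (1 + w\<^sup>2 / 2)"
    using ln_add1_ge[of "w\<^sup>2 / 2"] w2(1) by (simp add: add.commute)
  ultimately show ?thesis
    by linarith
qed

text \<open>When both permutations have few fixed points, take both generating functions at \<open>sqrt t\<close>.
  The 2-cycles then contribute at most \<open>(1 + t) powr ((1 - \<epsilon>) * n)\<close>, less by a factor
  \<open>(1 + t) powr (\<epsilon> * n)\<close> than the binomial coefficient, and the longer cycles do not make up for
  the difference.\<close>

lemma expected_invariant_balanced:
  assumes ne: "conj_class n c \<noteq> {}" "conj_class n c' \<noteq> {}" and k: "1 \<le> k" "2 * k \<le> n"
    and eps: "\<epsilon> > 0" "real (c 2 + c' 2) \<le> (1 - \<epsilon>) * real n"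
    and c1: "real (c 1) \<le> \<epsilon> / 72 * sqrt (real k * real n)"
    and c'1: "real (c' 1) \<le> \<epsilon> / 72 * sqrt (real k * real n)"
  shows "expected_invariant n c c' k \<le> exp 1 * real k * exp (- \<epsilon> * real k / 18)"
proof -
  define t where "t = real k / real (n - k)"
  define w where "w = sqrt t"
  define b where "b = real (c 2) + real (c' 2)"
  have nk: "0 < real n - real k" "real (n - k) = real n - real k" "0 < real k" "0 < real n" "2 * real k \<le> real n"
    using k by auto
  have t: "0 < t" "t \<le> 1" "real k \<le> real n * t" "real n * t \<le> 2 * real k"
  proof -
    show "0 < t" "t \<le> 1"
      using nk by (simp_all add: t_def)
    have "real k * (real n - real k) \<le> real n * real k"
      using nk by (simp add: algebra_simps)
    then show "real k \<le> real n * t"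
      using nk by (simp add: t_def field_simps)
    have "2 * real k * real k \<le> real n * real k"
      using nk by (intro mult_right_mono) auto
    then show "real n * t \<le> 2 * real k"
      using nk by (simp add: t_def field_simps)
  qed
  have w: "0 < w" "w \<le> 1" "w\<^sup>2 = t" "w * w = t"
    using t by (simp_all add: w_def)
  note fp = fixed_points_and_2_cycles_le[OF ne(1)] fixed_points_and_2_cycles_le[OF ne(2)]
  define L where "L = ln (1 + w ^ 3)"
  have "0 \<le> L"
    using w by (simp add: L_def)
  have *: "cycle_exponent n d w \<le> real (d 1) * w + real (d 2) * ln (1 + t) + (real n - 2 * real (d 2)) / 3 * L" for d
  proof -
    have "real (d 1) * ln (1 + w) \<le> real (d 1) * w"
      by (intro mult_left_mono ln_add_one_self_le_self) (use w in auto)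
    moreover have "(real n - real (d 1) - 2 * real (d 2)) / 3 * L \<le> (real n - 2 * real (d 2)) / 3 * L"
      using \<open>0 \<le> L\<close> by (intro mult_right_mono) auto
    ultimately show ?thesis
      unfolding cycle_exponent_def L_def w(3) by simp
  qed
  \<comment> \<open>The 2-cycles use up \<open>b * ln (1 + t)\<close> and the longer cycles
    \<open>2 / 3 * (n - b) * L\<close>, so the factor \<open>n - b\<close> comes out of everything
    but the fixed points.\<close>
  have "cycle_exponent n c w + cycle_exponent n c' w - real n * ln (1 + t)
      \<le> (real (c 1) + real (c' 1)) * w - (real n - b) * (ln (1 + t) - 2 / 3 * L)"
    using *[of c] *[of c'] by (simp add: b_def field_simps)
  \<comment> \<open>The constant \<open>1 / 72\<close> in the hypotheses makes the fixed points cost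
    \<open>1 / 24\<close>, well below the gain \<open>1 / 9\<close>.\<close>
  also have "\<dots> \<le> \<epsilon> * real k / 24 - \<epsilon> * real k / 9"
  proof (rule diff_mono)
    have "(sqrt (real k * real n) * w)\<^sup>2 = real k * (real n * t)"
      by (simp add: power_mult_distrib w)
    also have "\<dots> \<le> real k * (2 * real k)"
      using t nk by (intro mult_left_mono) auto
    also have "\<dots> \<le> (3 / 2 * real k)\<^sup>2"
      by (simp add: power2_eq_square)
    finally have **: "sqrt (real k * real n) * w \<le> 3 / 2 * real k"
      by (rule power2_le_imp_le) simp
    have "(real (c 1) + real (c' 1)) * w \<le> (\<epsilon> / 36 * sqrt (real k * real n)) * w"
      using c1 c'1 w by (intro mult_right_mono) auto
    also have "\<dots> = \<epsilon> / 36 * (sqrt (real k * real n) * w)"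
      by simp
    also have "\<dots> \<le> \<epsilon> / 36 * (3 / 2 * real k)"
      using ** eps by (intro mult_left_mono) auto
    finally show "(real (c 1) + real (c' 1)) * w \<le> \<epsilon> * real k / 24"
      by simp
    have "\<epsilon> * real k \<le> \<epsilon> * (real n * t)"
      using t eps by (intro mult_left_mono) auto
    then have "\<epsilon> * real k / 9 \<le> \<epsilon> * real n * (t / 9)"
      by simp
    also have "\<dots> \<le> (real n - b) * (ln (1 + t) - 2 / 3 * L)"
    proof (rule mult_mono)
      show "\<epsilon> * real n \<le> real n - b"
        using eps(2) by (simp add: b_def algebra_simps)
      then show "0 \<le> real n - b"
        using eps(1) nk by (smt (verit) mult_pos_pos)
      show "t / 9 \<le> ln (1 + t) - 2 / 3 * L"
        using ln_one_plus_square_minus_cube_ge[OF w(1,2)] by (simp add: w(3) L_def)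
    qed (use t in auto)
    finally show "\<epsilon> * real k / 9 \<le> (real n - b) * (ln (1 + t) - 2 / 3 * L)" .
  qed
  also have "\<dots> \<le> - \<epsilon> * real k / 18"
    using eps(1) nk by (simp add: field_simps)
  finally show ?thesis
    by (intro expected_invariant_le_exp[OF ne, of k w w t]) (use k w t_def in auto)
qed

text \<open>When the first permutation has many fixed points, so that the second has few fixed points and
  2-cycles, evaluate the first generating function at \<open>u * sqrt t\<close> and the second at \<open>sqrt t / u\<close>
  with \<open>u = s * sqrt (k * n) / c 1 < 1\<close>.\<close>

lemma expected_invariant_skewed:
  assumes ne: "conj_class n c \<noteq> {}" "conj_class n c' \<noteq> {}" and k: "1 \<le> k" "real k \<le> s\<^sup>2 * real n"
    and s: "0 < s" "s \<le> 1 / 72" and "C \<ge> 0"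
    and c1: "s * sqrt (real k * real n) < real (c 1)"
    and c1_cube: "real (c 1) ^ 3 \<le> C ^ 3 * (real n)\<^sup>2"
    and c1_c'1: "real (c 1) * real (c' 1) \<le> C * real n"
    and c1_c'2: "(real (c 1))\<^sup>2 * real (c' 2) \<le> C\<^sup>2 * (real n)\<^sup>2"
  shows "expected_invariant n c c' k
    \<le> exp 1 * real k * exp (2 * C / s + 2 * C\<^sup>2 / s\<^sup>2 + C ^ 3 / s ^ 3 - real k / 4)"
proof -
  define t where "t = real k / real (n - k)"
  define w where "w = sqrt t"
  define r where "r = sqrt (real k * real n)"
  define x where "x = s * r * w / real (c 1)"
  define y where "y = real (c 1) * w / (s * r)"
  have "s\<^sup>2 \<le> (1 / 72)\<^sup>2"
    using s by (intro power_mono) auto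
  then have "s\<^sup>2 * real n \<le> 1 / 4 * real n"
    by (intro mult_right_mono) (auto simp: power2_eq_square)
  then have k4: "4 * real k \<le> real n" "k < n"
    using k by auto
  then have nk: "0 < real n - real k" "real (n - k) = real n - real k" "0 < real k" "0 < real n"
    using k by auto
  have t: "0 < t" "real n * t \<le> 4 / 3 * real k" "real n * (t / (1 + t)) = real k"
  proof -
    show "0 < t"
      using nk by (simp add: t_def)
    have "4 * real k * real k \<le> real n * real k"
      using k4 by (intro mult_right_mono) auto
    then show "real n * t \<le> 4 / 3 * real k"
      using nk by (simp add: t_def field_simps)
    have "1 + t = real n / (real n - real k)"
      using nk by (simp add: t_def field_simps)
    then show "real n * (t / (1 + t)) = real k"
      using nk by (simp add: t_def)
  qed
  have w: "0 < w" "w\<^sup>2 = t" "w * w = t"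
    using t by (simp_all add: w_def)
  have r: "0 < r" "r\<^sup>2 = real k * real n"
    using nk by (simp_all add: r_def)
  have a: "0 < real (c 1)" "s * r < real (c 1)"
  proof -
    show "s * r < real (c 1)"
      using c1 by (simp add: r_def)
    moreover have "0 < s * r"
      using s r by simp
    ultimately show "0 < real (c 1)"
      by linarith
  qed
  have xy: "0 < x" "0 < y" "x * y = t"
    using a r s w by (simp_all add: x_def y_def)
  have rw: "r * w \<le> 4 / 3 * real k"
  proof (rule power2_le_imp_le)
    have "(r * w)\<^sup>2 = real k * (real n * t)"
      by (simp add: power_mult_distrib w r)
    also have "\<dots> \<le> real k * (4 / 3 * real k)"
      using t nk by (intro mult_left_mono) auto
    also have "\<dots> \<le> (4 / 3 * real k)\<^sup>2"
      by (simp add: power2_eq_square)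
    finally show "(r * w)\<^sup>2 \<le> (4 / 3 * real k)\<^sup>2" .
  qed simp
  have w_le: "w \<le> 4 / 3 * s"
  proof (rule power2_le_imp_le)
    have "real n * t \<le> 4 / 3 * (s\<^sup>2 * real n)"
      using t(2) k(2) by linarith
    then have "t \<le> 4 / 3 * s\<^sup>2"
      using nk by (simp add: field_simps)
    also have "\<dots> \<le> (4 / 3 * s)\<^sup>2"
      by (simp add: power2_eq_square)
    finally show "w\<^sup>2 \<le> (4 / 3 * s)\<^sup>2"
      by (simp add: w)
  qed (use s in simp)
  have x_le: "x \<le> w"
    using a w by (simp add: x_def field_simps)
  \<comment> \<open>As \<open>r * w\<close> is of order \<open>k\<close> and
    \<open>r^2 = k * n\<close>, the \<open>k\<close> cancels, so this bound depends on
    \<open>n\<close> and \<open>c 1\<close> alone.\<close>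
  have y_le: "y \<le> 4 / 3 * real (c 1) / (s * real n)"
  proof -
    have "y = real (c 1) * (r * w) / (s * r\<^sup>2)"
      using r(1) by (simp add: y_def power2_eq_square)
    also have "\<dots> \<le> real (c 1) * (4 / 3 * real k) / (s * r\<^sup>2)"
      using rw a s by (intro divide_right_mono mult_left_mono) auto
    also have "\<dots> = 4 / 3 * real (c 1) / (s * real n)"
      using nk by (simp add: r)
    finally show ?thesis .
  qed
  \<comment> \<open>The first class costs at most \<open>2 * k / 3 + 7 * s * k / 3\<close> in all.
    Against \<open>n * ln (1 + t) >= k\<close> and with \<open>s <= 1 / 72\<close>, a gain of
    \<open>k / 4\<close> is left.\<close>
  have "real (c 1) * x \<le> 4 / 3 * s * real k"
  proof -
    have "real (c 1) * x = s * (r * w)"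
      using a by (simp add: x_def)
    also have "\<dots> \<le> s * (4 / 3 * real k)"
      using rw s by (intro mult_left_mono) auto
    finally show ?thesis
      by simp
  qed
  moreover have "real (c 2) * x\<^sup>2 \<le> 2 / 3 * real k"
  proof -
    have "real (c 2) * x\<^sup>2 \<le> real n / 2 * w\<^sup>2"
      using fixed_points_and_2_cycles_le[OF ne(1)] x_le xy
      by (intro mult_mono power_mono) auto
    then show ?thesis
      using t(2) by (simp add: w)
  qed
  moreover have "real n * x ^ 3 / 3 \<le> s * real k"
  proof -
    have "real n * x ^ 3 \<le> real n * w ^ 3"
      using x_le xy by (intro mult_left_mono power_mono) auto
    also have "\<dots> = (real n * t) * w"
      by (simp add: power3_eq_cube w mult.assoc)
    also have "\<dots> \<le> (4 / 3 * real k) * (4 / 3 * s)"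
      by (rule mult_mono[OF t(2) w_le]) (use w in auto)
    also have "\<dots> \<le> 3 * (s * real k)"
      using s by simp
    finally show ?thesis
      by simp
  qed
  \<comment> \<open>The three terms of the second class are bounded independently of
    \<open>k\<close>.\<close>
  moreover have "real (c' 1) * y \<le> 2 * C / s"
  proof -
    have "real (c' 1) * y \<le> real (c' 1) * (4 / 3 * real (c 1) / (s * real n))"
      using y_le by (intro mult_left_mono) auto
    also have "\<dots> = 4 / 3 * (real (c 1) * real (c' 1)) / (s * real n)"
      by simp
    also have "\<dots> \<le> 4 / 3 * (C * real n) / (s * real n)"
      using c1_c'1 s nk by (intro divide_right_mono mult_left_mono) auto
    also have "\<dots> \<le> 2 * C / s"
      using nk s \<open>C \<ge> 0\<close> by (simp add: field_simps)
    finally show ?thesis .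
  qed
  moreover have "real (c' 2) * y\<^sup>2 \<le> 2 * C\<^sup>2 / s\<^sup>2"
  proof -
    have "real (c' 2) * y\<^sup>2 \<le> real (c' 2) * (4 / 3 * real (c 1) / (s * real n))\<^sup>2"
      using y_le xy by (intro mult_left_mono power_mono) auto
    also have "\<dots> = 16 / 9 * ((real (c 1))\<^sup>2 * real (c' 2)) / (s\<^sup>2 * (real n)\<^sup>2)"
      by (simp add: power_mult_distrib power_divide)
    also have "\<dots> \<le> 16 / 9 * (C\<^sup>2 * (real n)\<^sup>2) / (s\<^sup>2 * (real n)\<^sup>2)"
      using c1_c'2 by (intro divide_right_mono mult_left_mono) auto
    also have "\<dots> = 16 / 9 * (C\<^sup>2 / s\<^sup>2)"
      using nk by simp
    also have "\<dots> \<le> 2 * (C\<^sup>2 / s\<^sup>2)"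
      by (intro mult_right_mono) auto
    finally show ?thesis
      by simp
  qed
  moreover have "real n * y ^ 3 / 3 \<le> C ^ 3 / s ^ 3"
  proof -
    have "real n * y ^ 3 \<le> real n * (4 / 3 * real (c 1) / (s * real n)) ^ 3"
      using y_le xy by (intro mult_left_mono power_mono) auto
    also have "\<dots> = 64 / 27 * real (c 1) ^ 3 / (s ^ 3 * (real n)\<^sup>2)"
      using nk by (simp add: power_divide power2_eq_square power3_eq_cube mult.assoc mult.left_commute)
    also have "\<dots> \<le> 64 / 27 * (C ^ 3 * (real n)\<^sup>2) / (s ^ 3 * (real n)\<^sup>2)"
      using c1_cube s by (intro divide_right_mono mult_left_mono) auto
    also have "\<dots> = 64 / 27 * (C ^ 3 / s ^ 3)"
      using nk by simp
    also have "\<dots> \<le> 3 * (C ^ 3 / s ^ 3)"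
      using s \<open>C \<ge> 0\<close> by (intro mult_right_mono) auto
    finally show ?thesis
      by linarith
  qed
  moreover have "real k \<le> real n * ln (1 + t)"
  proof -
    have "t / (1 + t) \<le> ln (1 + t)"
      using ln_add1_ge[of t] t(1) by (simp add: add.commute)
    then have "real n * (t / (1 + t)) \<le> real n * ln (1 + t)"
      by (intro mult_left_mono) auto
    then show ?thesis
      by (simp only: t(3))
  qed
  moreover have "s * real k \<le> 1 / 72 * real k"
    using s by (intro mult_right_mono) auto
  ultimately have "cycle_exponent n c x + cycle_exponent n c' y - real n * ln (1 + t)
      \<le> 2 * C / s + 2 * C\<^sup>2 / s\<^sup>2 + C ^ 3 / s ^ 3 - real k / 4"
    using cycle_exponent_le[OF ne(1) xy(1)] cycle_exponent_le[OF ne(2) xy(2)] by linarith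
  then show ?thesis
    by (intro expected_invariant_le_exp[OF ne, of k x y t]) (use k k4 xy t_def in auto)
qed

text \<open>Having \<open>c 1\<close> above the threshold forces \<open>k\<close> to be of order at
  most \<open>n powr (1/3)\<close>. The assumption \<open>n\<close> says that \<open>n\<close> is
  large enough to turn this into \<open>k <= s^2 * n\<close>, as the skewed estimate
  requires.\<close>

lemma expected_invariant_le_of_many_fixed_points:
  fixes \<epsilon> C :: real
  defines "s \<equiv> \<epsilon> / 72"
  assumes ne: "conj_class n c \<noteq> {}" "conj_class n c' \<noteq> {}" and k: "1 \<le> k" "2 * k \<le> n"
    and eps: "0 < \<epsilon>" "\<epsilon> \<le> 1" and C: "C \<ge> 0"
    and c1: "real (c 1 + c' 1) \<le> C * real n powr (2/3)"
    and prod: "(real (c 1) + sqrt (real (c 2))) * (real (c' 1) + sqrt (real (c' 2))) \<le> C * real n"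
    and n: "C\<^sup>2 \<le> s ^ 4 * real n powr (2/3)"
    and skew: "s * sqrt (real k * real n) < real (c 1)"
  shows "expected_invariant n c c' k
    \<le> exp 1 * real k * exp (2 * C / s + 2 * C\<^sup>2 / s\<^sup>2 + C ^ 3 / s ^ 3 - real k / 4)"
proof -
  define q where "q = real n powr (2/3)"
  have nk: "0 < real n" "0 < real k"
    using k by auto
  have q: "0 < q" "q ^ 3 = (real n)\<^sup>2"
    using nk by (simp_all add: q_def powr_power)
  have s: "0 < s" "s \<le> 1 / 72"
    using eps by (simp_all add: s_def)
  have c1q: "real (c 1) \<le> C * q"
    using c1 by (simp add: q_def)
  \<comment> \<open>Applied below with \<open>z = c' 1\<close> and with
    \<open>z = sqrt (c' 2)\<close>.\<close>
  have prod_ge: "real (c 1) * z \<le> C * real n" if "z \<le> real (c' 1) + sqrt (real (c' 2))" "0 \<le> z" for z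
  proof -
    have "real (c 1) * z \<le> (real (c 1) + sqrt (real (c 2))) * (real (c' 1) + sqrt (real (c' 2)))"
      using that by (intro mult_mono) auto
    then show ?thesis
      using prod by linarith
  qed
  show ?thesis
  proof (rule expected_invariant_skewed[OF ne k(1) _ s C skew])
    have "(s * sqrt (real k * real n))\<^sup>2 \<le> (C * q)\<^sup>2"
      using skew c1q s by (intro power_mono) auto
    then have "s\<^sup>2 * (real k * real n) \<le> C\<^sup>2 * q\<^sup>2"
      by (simp add: power_mult_distrib)
    also have "\<dots> \<le> (s ^ 4 * q) * q\<^sup>2"
      using n by (intro mult_right_mono) (auto simp: q_def)
    also have "\<dots> = s ^ 4 * q ^ 3"
      by (simp add: power2_eq_square power3_eq_cube)
    also have "\<dots> = (s\<^sup>2 * real n) * (s\<^sup>2 * real n)"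
      unfolding q(2) by (simp add: power2_eq_square power4_eq_xxxx)
    finally have "(s\<^sup>2 * real n) * real k \<le> (s\<^sup>2 * real n) * (s\<^sup>2 * real n)"
      by (simp add: mult.assoc mult.commute mult.left_commute)
    then show "real k \<le> s\<^sup>2 * real n"
      by (rule mult_left_le_imp_le) (use s nk in simp)
    have "real (c 1) ^ 3 \<le> (C * q) ^ 3"
      using c1q by (intro power_mono) auto
    then show "real (c 1) ^ 3 \<le> C ^ 3 * (real n)\<^sup>2"
      by (simp add: power_mult_distrib q(2))
    show "real (c 1) * real (c' 1) \<le> C * real n"
      by (rule prod_ge) auto
    have "(real (c 1) * sqrt (real (c' 2)))\<^sup>2 \<le> (C * real n)\<^sup>2"
      by (intro power_mono prod_ge) auto
    then show "(real (c 1))\<^sup>2 * real (c' 2) \<le> C\<^sup>2 * (real n)\<^sup>2"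
      by (simp add: power_mult_distrib)
  qed
qed

text \<open>For each \<open>k\<close>, either one class exceeds the fixed-point threshold, giving
  the skewed bound up to exchanging the classes, or neither does, giving the balanced bound. Both
  are relaxed to the decay rate \<open>\<epsilon> / 18\<close>.\<close>

lemma expected_invariant_le_uniform:
  fixes \<epsilon> C :: real
  defines "s \<equiv> \<epsilon> / 72"
  assumes ne: "conj_class n c \<noteq> {}" "conj_class n c' \<noteq> {}" and k: "1 \<le> k" "2 * k \<le> n"
    and eps: "0 < \<epsilon>" "\<epsilon> \<le> 1" and c2: "real (c 2 + c' 2) \<le> (1 - \<epsilon>) * real n" and C: "C \<ge> 0"
    and c1: "real (c 1 + c' 1) \<le> C * real n powr (2/3)"
    and prod: "(real (c 1) + sqrt (real (c 2))) * (real (c' 1) + sqrt (real (c' 2))) \<le> C * real n"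
    and n: "C\<^sup>2 \<le> s ^ 4 * real n powr (2/3)"
  shows "expected_invariant n c c' k
    \<le> exp (1 + (2 * C / s + 2 * C\<^sup>2 / s\<^sup>2 + C ^ 3 / s ^ 3)) * (real k * exp (- (\<epsilon> / 18)) ^ k)"
proof -
  define M where "M = 2 * C / s + 2 * C\<^sup>2 / s\<^sup>2 + C ^ 3 / s ^ 3"
  have "0 \<le> M"
    using C eps by (simp add: M_def s_def)
  have le: "expected_invariant n c c' k \<le> exp (1 + M) * (real k * exp (- (\<epsilon> / 18)) ^ k)"
    if "expected_invariant n c c' k \<le> exp 1 * real k * exp E" "E \<le> M - \<epsilon> * real k / 18" for E
  proof -
    have "exp 1 * real k * exp E \<le> exp 1 * real k * exp (M - \<epsilon> * real k / 18)"
      using that by (intro mult_left_mono) auto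
    also have "M - \<epsilon> * real k / 18 = M + real k * (- (\<epsilon> / 18))"
      by simp
    also have "exp 1 * real k * exp (M + real k * (- (\<epsilon> / 18))) = exp (1 + M) * (real k * exp (- (\<epsilon> / 18)) ^ k)"
      by (simp only: exp_add exp_of_nat_mult mult.assoc mult.commute mult.left_commute)
    finally show ?thesis
      using that by linarith
  qed
  have k4: "\<epsilon> * real k / 18 \<le> real k / 4"
  proof -
    have "\<epsilon> * real k \<le> 1 * real k"
      using eps by (intro mult_right_mono) auto
    then show ?thesis
      by simp
  qed
  consider "s * sqrt (real k * real n) < real (c 1)" | "s * sqrt (real k * real n) < real (c' 1)"
    | "real (c 1) \<le> s * sqrt (real k * real n)" "real (c' 1) \<le> s * sqrt (real k * real n)"
    by linarith
  then have "expected_invariant n c c' k \<le> exp (1 + M) * (real k * exp (- (\<epsilon> / 18)) ^ k)"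
  proof cases
    case 1
    show ?thesis
      using k4 expected_invariant_le_of_many_fixed_points[of n c c' k \<epsilon> C, OF ne k eps C c1 prod n[unfolded s_def] 1[unfolded s_def]]
      by (intro le) (auto simp: M_def s_def)
  next
    case 2
    have c1': "real (c' 1 + c 1) \<le> C * real n powr (2/3)"
      and prod': "(real (c' 1) + sqrt (real (c' 2))) * (real (c 1) + sqrt (real (c 2))) \<le> C * real n"
      using c1 prod by (simp_all add: mult.commute add.commute)
    show ?thesis
      using k4 expected_invariant_le_of_many_fixed_points[of n c' c k \<epsilon> C, OF ne(2,1) k eps C c1' prod' n[unfolded s_def] 2[unfolded s_def]]
      by (intro le) (auto simp: M_def s_def expected_invariant_commute[of n c c'])
  next
    case 3
    show ?thesis
      using expected_invariant_balanced[OF ne k eps(1) c2 3[unfolded s_def]] \<open>0 \<le> M\<close>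
      by (intro le) auto
  qed
  then show ?thesis
    by (simp only: M_def)
qed

text \<open>For fixed \<open>k\<close> evaluate the generating functions at the inverses of
  \<open>max (c 1 + sqrt (c 2)) (n powr (1/3))\<close> and of its counterpart for \<open>c'\<close>, so that both
  exponents stay bounded.\<close>

lemma expected_invariant_le_small:
  fixes \<delta> :: real
  assumes ne: "conj_class n c \<noteq> {}" "conj_class n c' \<noteq> {}" and k: "1 \<le> k" "k \<le> n"
    and d: "\<delta> > 0" "2 * \<delta> * real k \<le> 1"
    and c1: "real (c 1 + c' 1) \<le> \<delta> * real n powr (2/3)"
    and prod: "(real (c 1) + sqrt (real (c 2))) * (real (c' 1) + sqrt (real (c' 2))) \<le> \<delta> * real n"
    and n: "1 \<le> \<delta> * real n powr (1/6)"
  shows "expected_invariant n c c' k \<le> exp 5 * (2 * \<delta> * real k)"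
proof -
  define m where "m = real n powr (1/3)"
  have nk: "0 < real n" "0 < real k" "1 \<le> real n"
    using k by auto
  have m: "0 < m" "m ^ 3 = real n" "m * m * m = real n" "real n powr (2/3) = m * m"
    using nk by (simp_all add: m_def powr_power flip: powr_add)
  \<comment> \<open>Only \<open>c 2 <= n\<close> bounds the 2-cycles of a single class; the gap
    \<open>n powr (1/6)\<close> between \<open>sqrt n\<close> and \<open>n powr (2/3)\<close> makes
    up for it.\<close>
  have sqrt_n: "sqrt (real n) \<le> \<delta> * (m * m)"
  proof -
    have "1 * real n powr (1/2) \<le> (\<delta> * real n powr (1/6)) * real n powr (1/2)"
      using n by (intro mult_right_mono) auto
    also have "\<dots> = \<delta> * real n powr (1/6 + 1/2)"
      by (simp only: powr_add mult.assoc)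
    also have "\<dots> = \<delta> * (m * m)"
      by (simp flip: m(4))
    finally show ?thesis
      using nk by (simp add: powr_half_sqrt)
  qed
  have mm: "m * m \<le> \<delta> * real n"
  proof -
    have "1 \<le> real n powr (1/6)"
      using nk by (intro ge_one_powr_ge_zero) auto
    then have "real n powr (1/6) \<le> real n powr (1/6) * real n powr (1/6)"
      using mult_left_mono[of 1 "real n powr (1/6)" "real n powr (1/6)"] by simp
    also have "\<dots> = m"
      by (simp add: m_def flip: powr_add)
    finally have "\<delta> * real n powr (1/6) \<le> \<delta> * m"
      using d by (intro mult_left_mono) auto
    then have "1 \<le> \<delta> * m"
      using n by linarith
    then have "(m * m) * 1 \<le> (m * m) * (\<delta> * m)"
      using m by (intro mult_left_mono) auto
    also have "\<dots> = \<delta> * real n"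
      unfolding m(3)[symmetric] by simp
    finally show ?thesis
      by simp
  qed
  define D where "D d = real (d 1) + sqrt (real (d 2))" for d :: "nat \<Rightarrow> nat"
  define z where "z d = 1 / max (D d) m" for d :: "nat \<Rightarrow> nat"
  \<comment> \<open>The three terms of \<open>cycle_exponent_le\<close> are at most
    \<open>1\<close>, \<open>1\<close> and \<open>1 / 3\<close>.\<close>
  have zpos: "0 < z d" and exp_z: "conj_class n d \<noteq> {} \<Longrightarrow> cycle_exponent n d (z d) \<le> 5 / 2" for d :: "nat \<Rightarrow> nat"
  proof -
    show z0: "0 < z d"
      using m(1) by (simp add: z_def)
    assume ne: "conj_class n d \<noteq> {}"
    have zD: "z d * D d \<le> 1" and zm: "z d * m \<le> 1"
      using m(1) by (auto simp: z_def divide_le_eq_1 max_def)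
    have "real (d 1) * z d \<le> D d * z d"
      using z0 by (intro mult_right_mono) (auto simp: D_def)
    then have a: "real (d 1) * z d \<le> 1"
      using zD by (simp add: mult.commute)
    have "sqrt (real (d 2)) * z d \<le> D d * z d"
      using z0 by (intro mult_right_mono) (auto simp: D_def)
    then have "sqrt (real (d 2)) * z d \<le> 1"
      using zD by (simp add: mult.commute)
    then have "(sqrt (real (d 2)) * z d)\<^sup>2 \<le> 1\<^sup>2"
      using z0 by (intro power_mono) auto
    then have b: "real (d 2) * (z d)\<^sup>2 \<le> 1"
      by (simp add: power_mult_distrib)
    have "(z d * m) ^ 3 \<le> 1 ^ 3"
      using zm z0 m(1) by (intro power_mono) auto
    then have "real n * (z d) ^ 3 \<le> 1"
      by (simp add: power_mult_distrib m(2) mult.commute)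
    then show "cycle_exponent n d (z d) \<le> 5 / 2"
      using a b cycle_exponent_le[OF ne z0] by linarith
  qed
  \<comment> \<open>This covers the mixed cases when the product of the two maxima is
    expanded.\<close>
  have D_le: "D d * m \<le> 2 * \<delta> * real n" if "conj_class n d \<noteq> {}" "d = c \<or> d = c'" for d :: "nat \<Rightarrow> nat"
  proof -
    have "real (d 2) \<le> real n"
      using fixed_points_and_2_cycles_le[OF that(1)] by linarith
    then have "sqrt (real (d 2)) \<le> \<delta> * (m * m)"
      using sqrt_n by (meson order_trans real_sqrt_le_mono)
    moreover have "real (d 1) \<le> \<delta> * (m * m)"
      using c1 that(2) by (auto simp: m(4))
    ultimately have "D d * m \<le> (2 * \<delta> * (m * m)) * m"
      using m(1) by (intro mult_right_mono) (auto simp: D_def)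
    then show ?thesis
      using m(3) by (simp add: mult.assoc)
  qed
  have prod': "max (D c) m * max (D c') m \<le> 2 * \<delta> * real n"
  proof -
    have "0 \<le> \<delta> * real n"
      using d nk by simp
    then have "D c * D c' \<le> 2 * \<delta> * real n" "m * m \<le> 2 * \<delta> * real n"
      using prod mm unfolding D_def by linarith+
    then show ?thesis
      using D_le[of c] D_le[of c'] ne by (auto simp: max_def mult.commute)
  qed
  have "expected_invariant n c c' k
      \<le> exp (cycle_exponent n c (z c) + cycle_exponent n c' (z c')) / (z c * z c') ^ k * (1 / real (n choose k))"
    by (rule expected_invariant_le) (use ne k zpos in auto)
  also have "\<dots> \<le> exp 5 / (z c * z c') ^ k * (real k / real n) ^ k"
    using exp_z[OF ne(1)] exp_z[OF ne(2)] zpos k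
    by (intro mult_mono divide_right_mono power_div_le_binomial) (auto simp: less_imp_le)
  also have "\<dots> = exp 5 * (max (D c) m * max (D c') m * real k / real n) ^ k"
    by (simp add: z_def power_mult_distrib power_divide)
  also have "\<dots> \<le> exp 5 * (2 * \<delta> * real k) ^ k"
  proof (intro mult_left_mono power_mono)
    have "max (D c) m * max (D c') m * real k \<le> 2 * \<delta> * real n * real k"
      using prod' by (intro mult_right_mono) auto
    then show "max (D c) m * max (D c') m * real k / real n \<le> 2 * \<delta> * real k"
      using nk by (simp add: field_simps)
    show "0 \<le> max (D c) m * max (D c') m * real k / real n"
      using m(1) by (simp add: max_def)
  qed simp
  \<comment> \<open>The base is at most \<open>1\<close> and \<open>k >= 1\<close>, so one factor of
    the power suffices.\<close>
  also have "\<dots> \<le> exp 5 * (2 * \<delta> * real k) ^ 1"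
    using d k by (intro mult_left_mono power_decreasing) auto
  finally show ?thesis
    by simp
qed

section \<open>Auxiliary facts on series and growth\<close>

text \<open>The differentiated geometric series minus the geometric series itself.\<close>

lemma summable_index_power:
  fixes r :: real
  assumes "\<bar>r\<bar> < 1"
  shows "summable (\<lambda>k. real k * r ^ k)"
proof -
  have "summable (\<lambda>k. of_nat (Suc k) * r ^ k - r ^ k)"
    using assms by (intro summable_diff sums_summable[OF geometric_deriv_sums] summable_geometric) auto
  then show ?thesis
    by (simp add: algebra_simps)
qed

lemma smallo_eventually_le:
  fixes f g :: "nat \<Rightarrow> real"
  assumes "f \<in> o(g)" "d > 0" "\<And>n. g n \<ge> 0"
  shows "eventually (\<lambda>n. f n \<le> d * g n) sequentially"
  using landau_o.smallD[OF assms(1,2)] by eventually_elim (use assms(3) in auto)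

lemma eventually_ge_mult_powr:
  assumes "d > 0" "a > 0"
  shows "eventually (\<lambda>n. B \<le> d * real n powr a) sequentially"
proof -
  have "filterlim (\<lambda>n. real n powr a) at_top sequentially"
    using assms(2) by real_asymp
  then have "eventually (\<lambda>n. B / d \<le> real n powr a) sequentially"
    by (simp add: filterlim_at_top)
  then show ?thesis
    by eventually_elim (use assms in \<open>simp add: field_simps\<close>)
qed

section \<open>Asymptotics\<close>

text \<open>For large \<open>n\<close> the uniform bound majorises the sum over \<open>k\<close> by
  a convergent series independent of \<open>n\<close>.\<close>

lemma EN_bigo:
  fixes c c' :: "nat \<Rightarrow> nat \<Rightarrow> nat"
  assumes nonempty: "\<And>n. conj_class n (c n) \<noteq> {}" "\<And>n. conj_class n (c' n) \<noteq> {}"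
    and c1: "(\<lambda>n. real (c n 1 + c' n 1)) \<in> O(\<lambda>n. real n powr (2/3))"
    and prod: "(\<lambda>n. (real (c n 1) + sqrt (real (c n 2))) * (real (c' n 1) + sqrt (real (c' n 2))))
        \<in> O(\<lambda>n. real n)"
    and eps: "\<epsilon> > 0" "\<And>n. real (c n 2 + c' n 2) \<le> (1 - \<epsilon>) * real n"
  shows "(\<lambda>n. EN n (c n) (c' n)) \<in> O(\<lambda>n. 1)"
proof -
  \<comment> \<open>The given constant may exceed \<open>1\<close>, but the uniform bound asks for
    at most \<open>1\<close>; shrinking it only weakens the condition on 2-cycles.\<close>
  define e where "e = min \<epsilon> 1"
  have e: "0 < e" "e \<le> 1"
    using eps(1) by (simp_all add: e_def)
  have c2: "real (c n 2 + c' n 2) \<le> (1 - e) * real n" for n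
  proof -
    have "(1 - \<epsilon>) * real n \<le> (1 - e) * real n"
      by (intro mult_right_mono) (auto simp: e_def)
    then show ?thesis
      using eps(2)[of n] by linarith
  qed
  obtain C1 where C1: "eventually (\<lambda>n. norm (real (c n 1 + c' n 1)) \<le> C1 * norm (real n powr (2/3))) sequentially"
    using landau_o.bigE[OF c1] by blast
  obtain C2 where C2: "eventually (\<lambda>n. norm ((real (c n 1) + sqrt (real (c n 2))) * (real (c' n 1) + sqrt (real (c' n 2))))
      \<le> C2 * norm (real n)) sequentially"
    using landau_o.bigE[OF prod] by blast
  define C where "C = max 0 (max C1 C2)"
  define s where "s = e / 72"
  define M where "M = exp (1 + (2 * C / s + 2 * C\<^sup>2 / s\<^sup>2 + C ^ 3 / s ^ 3))"
  define a where "a = (\<lambda>k. real k * exp (- (e / 18)) ^ k)"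
  have sum_a: "summable a"
    unfolding a_def using e by (intro summable_index_power) auto
  have ev_n: "eventually (\<lambda>n. C\<^sup>2 \<le> s ^ 4 * real n powr (2/3)) sequentially"
    by (rule eventually_ge_mult_powr) (use e in \<open>auto simp: s_def\<close>)
  have "eventually (\<lambda>n. EN n (c n) (c' n) \<le> M * suminf a) sequentially"
    using C1 C2 ev_n
  proof eventually_elim
    case (elim n)
    have le: "y \<le> D * x \<Longrightarrow> D \<le> C \<Longrightarrow> 0 \<le> x \<Longrightarrow> y \<le> C * x" for x y D :: real
      using mult_right_mono[of D C x] by linarith
    have "EN n (c n) (c' n) \<le> (\<Sum>k = 1..n div 2. expected_invariant n (c n) (c' n) k)"
      by (rule EN_le_sum_expected_invariant) (rule nonempty)+
    also have "\<dots> \<le> (\<Sum>k = 1..n div 2. M * a k)"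
    proof (rule sum_mono)
      fix k assume k: "k \<in> {1..n div 2}"
      show "expected_invariant n (c n) (c' n) k \<le> M * a k"
        unfolding M_def a_def s_def
      proof (rule expected_invariant_le_uniform[OF nonempty _ _ e c2])
        show "real (c n 1 + c' n 1) \<le> C * real n powr (2/3)"
          by (rule le[of _ C1]) (use elim(1) in \<open>auto simp: C_def\<close>)
        show "(real (c n 1) + sqrt (real (c n 2))) * (real (c' n 1) + sqrt (real (c' n 2))) \<le> C * real n"
          by (rule le[of _ C2]) (use elim(2) in \<open>auto simp: C_def\<close>)
        show "C\<^sup>2 \<le> (e / 72) ^ 4 * real n powr (2/3)"
          using elim(3) e by (simp add: s_def)
      qed (use k in \<open>auto simp: C_def\<close>)
    qed
    also have "\<dots> = M * (\<Sum>k = 1..n div 2. a k)"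
      by (simp add: sum_distrib_left)
    also have "\<dots> \<le> M * suminf a"
      by (intro mult_left_mono sum_le_suminf sum_a) (auto simp: a_def M_def)
    finally show ?case .
  qed
  then show ?thesis
    by (intro bigoI[where c = "M * suminf a"]) (simp add: EN_nonneg)
qed

lemma EN_smallo:
  fixes c c' :: "nat \<Rightarrow> nat \<Rightarrow> nat"
  assumes nonempty: "\<And>n. conj_class n (c n) \<noteq> {}" "\<And>n. conj_class n (c' n) \<noteq> {}"
    and c1: "(\<lambda>n. real (c n 1 + c' n 1)) \<in> o(\<lambda>n. real n powr (2/3))"
    and prod: "(\<lambda>n. (real (c n 1) + sqrt (real (c n 2))) * (real (c' n 1) + sqrt (real (c' n 2))))
        \<in> o(\<lambda>n. real n)"
  shows "(\<lambda>n. EN n (c n) (c' n)) \<in> o(\<lambda>n. 1)"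
proof -
  \<comment> \<open>Extension by zero makes the index range independent of \<open>n\<close>, as
    Tannery's theorem requires.\<close>
  define f where "f k n = (if 1 \<le> k \<and> 2 * k \<le> n then expected_invariant n (c n) (c' n) k else 0)" for k n
  have f_nonneg: "0 \<le> f k n" for k n
    by (simp add: f_def expected_invariant_nonneg)
  have ev: "eventually (\<lambda>n. real (c n 1 + c' n 1) \<le> d * real n powr (2/3) \<and>
      (real (c n 1) + sqrt (real (c n 2))) * (real (c' n 1) + sqrt (real (c' n 2))) \<le> d * real n) sequentially"
    if "d > 0" for d
    using smallo_eventually_le[OF c1 that] smallo_eventually_le[OF prod that] by (simp add: eventually_conj)
  \<comment> \<open>The uniform bound with both constants equal to \<open>1 / 4\<close>.\<close>
  define M where "M k = exp (1 + (2 * (1/4) / ((1/4) / 72) + 2 * (1/4)\<^sup>2 / ((1/4) / 72)\<^sup>2 + (1/4) ^ 3 / ((1/4) / 72) ^ 3))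
    * (real k * exp (- ((1/4) / 18)) ^ k)" for k :: nat
  have lim: "(\<lambda>n. f k n) \<longlonglongrightarrow> 0" for k
  proof (cases "k = 0")
    case False
    then have k: "1 \<le> k" by simp
    show ?thesis
    proof (rule LIMSEQ_I)
      fix r :: real assume r: "0 < r"
      \<comment> \<open>The first entry gives \<open>2 * d * k <= 1\<close>; the second brings the
        bound down to \<open>r / 2\<close>.\<close>
      define d where "d = min (1 / (2 * real k)) (r / (2 * (exp 5 * (2 * real k))))"
      have d: "0 < d" "2 * d * real k \<le> 1" "exp 5 * (2 * d * real k) < r"
      proof -
        show "0 < d"
          using r k by (simp add: d_def)
        have "d \<le> 1 / (2 * real k)"
          by (simp add: d_def)
        then show "2 * d * real k \<le> 1"
          using k by (simp add: field_simps)
        have "d \<le> r / (2 * (exp 5 * (2 * real k)))"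
          by (simp add: d_def)
        then have "2 * (exp 5 * (2 * d * real k)) \<le> r"
          using k by (simp add: field_simps)
        then show "exp 5 * (2 * d * real k) < r"
          using r by linarith
      qed
      have ev_n: "eventually (\<lambda>n. 1 \<le> d * real n powr (1/6)) sequentially"
        by (rule eventually_ge_mult_powr) (use d in auto)
      have "eventually (\<lambda>n. norm (f k n - 0) < r) sequentially"
        using ev[OF d(1)] ev_n eventually_ge_at_top[of "2 * k"]
      proof eventually_elim
        case (elim n)
        have "expected_invariant n (c n) (c' n) k \<le> exp 5 * (2 * d * real k)"
          by (rule expected_invariant_le_small) (use nonempty elim d k in auto)
        then show ?case
          using d(3) f_nonneg[of k n] r by (simp add: f_def)
      qed
      then show "\<exists>N. \<forall>n\<ge>N. norm (f k n - 0) < r"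
        by (simp add: eventually_sequentially)
    qed
  qed (simp add: f_def)
  have ev_n: "eventually (\<lambda>n. (1/4)\<^sup>2 \<le> ((1/4) / 72) ^ 4 * real n powr (2/3)) sequentially"
    by (rule eventually_ge_mult_powr) auto
  have ev_quarter: "eventually (\<lambda>n. real (c n 1 + c' n 1) \<le> 1/4 * real n powr (2/3) \<and>
      (real (c n 1) + sqrt (real (c n 2))) * (real (c' n 1) + sqrt (real (c' n 2))) \<le> 1/4 * real n) sequentially"
    by (rule ev) simp
  have bound: "eventually (\<lambda>n. \<forall>k. norm (f k n) \<le> M k) sequentially"
    using ev_quarter ev_n
  proof eventually_elim
    case (elim n)
    have prod_n: "(real (c n 1) + sqrt (real (c n 2))) * (real (c' n 1) + sqrt (real (c' n 2))) \<le> 1/4 * real n"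
      using elim(1) by simp
    \<comment> \<open>Each class has at most \<open>n / 2\<close> 2-cycles. If together they had
      more than \<open>3 * n / 4\<close>, each would have more than \<open>n / 4\<close>, and the
      product hypothesis would fail.\<close>
    have c2: "real (c n 2 + c' n 2) \<le> (1 - 1/4) * real n"
    proof (rule ccontr)
      assume "\<not> ?thesis"
      then have "real n / 4 < real (c n 2)" "real n / 4 < real (c' n 2)"
        using fixed_points_and_2_cycles_le[OF nonempty(1)[of n]] fixed_points_and_2_cycles_le[OF nonempty(2)[of n]]
        by auto
      then have "sqrt (real n / 4) * sqrt (real n / 4) < sqrt (real (c n 2)) * sqrt (real (c' n 2))"
        by (intro mult_strict_mono') auto
      also have "\<dots> \<le> (real (c n 1) + sqrt (real (c n 2))) * (real (c' n 1) + sqrt (real (c' n 2)))"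
        by (intro mult_mono) auto
      finally show False
        using prod_n by simp
    qed
    show ?case
    proof
      fix k
      have "expected_invariant n (c n) (c' n) k \<le> M k" if "1 \<le> k" "2 * k \<le> n"
        unfolding M_def
        by (rule expected_invariant_le_uniform[OF nonempty that _ _ c2]) (use elim in auto)
      moreover have "0 \<le> M k"
        by (simp add: M_def)
      ultimately show "norm (f k n) \<le> M k"
        using f_nonneg[of k n] by (simp add: f_def)
    qed
  qed
  have "summable M"
    unfolding M_def by (intro summable_mult summable_index_power) auto
  \<comment> \<open>The bound holds for all \<open>k\<close> at once, so the condition on the first
    coordinate of the product filter can be trivial.\<close>
  have "eventually (\<lambda>(k, n). norm (f k n) \<le> M k) (at_top \<times>\<^sub>F sequentially)"
    unfolding eventually_prod_filter case_prod_conv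
    by (rule exI[of _ "\<lambda>_. True"], rule exI[of _ "\<lambda>n. \<forall>k. norm (f k n) \<le> M k"]) (use bound in simp)
  from tannerys_theorem[OF lim this \<open>summable M\<close>]
  have sum_lim: "(\<lambda>n. \<Sum>k. f k n) \<longlonglongrightarrow> 0"
    by simp
  have EN_le: "EN n (c n) (c' n) \<le> (\<Sum>k. f k n)" for n
  proof -
    have "(\<Sum>k. f k n) = (\<Sum>k = 1..n div 2. f k n)"
      by (rule suminf_finite) (auto simp: f_def)
    also have "\<dots> = (\<Sum>k = 1..n div 2. expected_invariant n (c n) (c' n) k)"
      by (rule sum.cong) (auto simp: f_def)
    finally show ?thesis
      using EN_le_sum_expected_invariant[OF nonempty, of n] by simp
  qed
  have "(\<lambda>n. EN n (c n) (c' n)) \<longlonglongrightarrow> 0"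
    by (rule tendsto_sandwich[OF always_eventually always_eventually tendsto_const sum_lim])
      (intro allI EN_nonneg EN_le)+
  then show ?thesis
    by (intro smalloI_tendsto) auto
qed

theorem theorem3p5:
  fixes c c' :: "nat \<Rightarrow> nat \<Rightarrow> nat"
  assumes nonempty: "\<And>n. conj_class n (c n) \<noteq> {}" "\<And>n. conj_class n (c' n) \<noteq> {}"
  shows
   "((\<lambda>n. real (c n 1 + c' n 1)) \<in> o(\<lambda>n. real n powr (2/3)) \<and>
     (\<lambda>n. (real (c n 1) + sqrt (real (c n 2))) * (real (c' n 1) + sqrt (real (c' n 2))))
        \<in> o(\<lambda>n. real n)
     \<longrightarrow> (\<lambda>n. EN n (c n) (c' n)) \<in> o(\<lambda>n. 1))
  \<and> ((\<lambda>n. real (c n 1 + c' n 1)) \<in> O(\<lambda>n. real n powr (2/3)) \<and>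
     (\<lambda>n. (real (c n 1) + sqrt (real (c n 2))) * (real (c' n 1) + sqrt (real (c' n 2))))
        \<in> O(\<lambda>n. real n) \<and>
     (\<exists>\<epsilon>>0. \<forall>n. real (c n 2 + c' n 2) \<le> (1 - \<epsilon>) * real n)
     \<longrightarrow> (\<lambda>n. EN n (c n) (c' n)) \<in> O(\<lambda>n. 1))"
proof (intro conjI impI; elim conjE exE)
  fix \<epsilon> :: real
  assume "(\<lambda>n. real (c n 1 + c' n 1)) \<in> O(\<lambda>n. real n powr (2/3))"
    "(\<lambda>n. (real (c n 1) + sqrt (real (c n 2))) * (real (c' n 1) + sqrt (real (c' n 2)))) \<in> O(\<lambda>n. real n)"
    "0 < \<epsilon>" "\<forall>n. real (c n 2 + c' n 2) \<le> (1 - \<epsilon>) * real n"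
  then show "(\<lambda>n. EN n (c n) (c' n)) \<in> O(\<lambda>n. 1)"
    by (intro EN_bigo[OF nonempty]) auto
qed (rule EN_smallo[OF nonempty])

end
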